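(* Assume that $\varphi$ is non-contractive, and let $(S,\iota)$ be a free analytic 1-submanifold of $M$ with $S\cong D$ (homeomorphic to an interval) and $S\notin\mathcal F(S)$. Let $z\in\mathrm{int}[S]$ and let $[g]$ be a $z$-decomposition of $S$, with corresponding segments $\Sigma_\pm$. Then: 1) $\mathcal M(S)=\{\Sigma_-,\Sigma_+\}$. 2) If $g'\cdot\iota|_{\Sigma_-}\sim_\circ\iota$ holds for $g'\in G$, then $[g']\in\{[e],[g]\}$. 3) $[g^{-1}]=[g]$. 4) There exists no further $z$-decomposition of $S$: if $[g']$ is a $z'$-decomposition of $S$ (with $[e]\neq[g']\in\mathcal H(S)$ and $z'\in\mathrm{int}[S]$), then $z'=z$ and $[g']=[g]$.
   Context: Manifolds and Lie groups are finite-dimensional, Hausdorff, real analytic, without boundary unless stated otherwise, and not assumed second countable. $\varphi\colon G\times M\to M$, $(g,x)\mapsto g\cdot x$, is a left action of a Lie group $G$ on an analytic manifold $M$ such that $g\mapsto g\cdot x$ is continuous for each $x\in M$. $\varphi$ is analytic in $M$ if $x\mapsto g\cdot x$ is analytic for each $g\in G$; it is non-contractive if it is analytic in $M$ and for each $C\subseteq M$ with $|C|\ge 2$ and each $x\in M\setminus C$ there is a neighbourhood $U$ of $x$ with $g\cdot C\not\subseteq U$ for all $g\in G$. An analytic 1-submanifold $(S,\iota)$ of $M$ consists of a connected, Hausdorff, second countable 1-dimensional analytic manifold $S$ with (possibly empty) boundary and an injective analytic immersion $\iota\colon S\to M$. $S\cong D$ means that there is a homeomorphism $\upsilon\colon D\to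 S$ with $D\subseteq\mathbb R$ a nondegenerate interval. A segment is a connected subset of $S$ with more than one point; $\mathrm{Seg}(S)$ is the set of segments. For $\Sigma\in\mathrm{Seg}(S)$: $\mathrm{int}[\Sigma]:=\upsilon(\text{interior of }\upsilon^{-1}(\Sigma)\text{ in }\mathbb R)$ and $\partial_\Sigma:=\Sigma\setminus\mathrm{int}[\Sigma]$. A boundary segment of $\Sigma$ is a segment $\Sigma'\subseteq\Sigma$ with $\Sigma\setminus\Sigma'$ connected (possibly empty). $g\cdot\iota$ denotes $z\mapsto g\cdot\iota(z)$; $G_x$ is the stabilizer of $x\in M$, $G_z:=G_{\iota(z)}$ for $z\in S$, $G_S:=\bigcap_{z\in S}G_{\iota(z)}$, $\mathcal H(S):=G/G_S$ (left cosets), and $[g]\in\mathcal H(S)$ is the class of $g$. For $\Sigma,\Sigma'\in\mathrm{Seg}(S)$ and $g\in G$, write $g\cdot\iota|_\Sigma\sim_\circ\iota|_{\Sigma'}$ if $g\cdot\iota(O)=\iota(O')$ for open (in $S$) segments $O\subseteq\Sigma$, $O'\subseteq\Sigma'$ on which $\iota$ is an embedding (with $\Sigma'=S$ if no restriction is written). $\Sigma\in\mathrm{Seg}(S)$ is a free segment, $\Sigma\in\mathcal F(S)$, if for $g\in G$: $g\cdot\iota|_\Sigma\sim_\circ\iota|_\Sigma\Leftrightarrow g\in G_S$. $\mathcal M(S)$ is the set of inclusion-maximal elements of $\mathcal F(S)$. $(S,\iota)$ is free if $\mathcal F(S)\neq\emptyset$. $z$-decomposition. For $S\cong D$ and $z\in\mathrm{int}[S]$,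 a $z$-decomposition of $S$ is a class $[e]\neq[g]\in\mathcal H(S)$ with $g\in G_z$ such that (a) there are compact segments $K_\pm\subseteq S$ with $g\cdot\iota(K_-)=\iota(K_+)$ and $K_-\cap K_+=\{z\}$; (b) $\Sigma_\pm\in\mathcal F(S)$ for the unique boundary segments $\Sigma_\pm$ of $S$ with $S=\Sigma_-\cup\Sigma_+$, $\Sigma_-\cap\Sigma_+=\partial_{\Sigma_-}\cap\partial_{\Sigma_+}=\{z\}$, $K_\pm\subseteq\Sigma_\pm$. *)

theory Defs
  imports "HOL-Analysis.Analysis" "HOL-Algebra.Group_Action"
begin

section \<open>Real analytic functions of several variables\<close>

text \<open>
  Points of \<open>\<real>\<^sup>n\<close> are functions \<open>nat \<Rightarrow> real\<close> vanishing from index \<open>n\<close> on,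
  as in \<^const>\<open>Euclidean_space\<close>. The dimension \<open>n = 0\<close> is allowed, so that discrete groups
  are Lie groups.
\<close>

definition multi_indices :: "nat \<Rightarrow> (nat \<Rightarrow> nat) set" where
  "multi_indices n = {\<alpha>. \<forall>i\<ge>n. \<alpha> i = 0}"

definition power_series_term ::
    "nat \<Rightarrow> ((nat \<Rightarrow> nat) \<Rightarrow> real) \<Rightarrow> (nat \<Rightarrow> real) \<Rightarrow> (nat \<Rightarrow> real) \<Rightarrow> (nat \<Rightarrow> nat) \<Rightarrow> real" where
  "power_series_term n c p x \<alpha> = c \<alpha> * (\<Prod>i<n. (x i - p i) ^ \<alpha> i)"

text \<open>
  The power series at \<open>p\<close> has to converge on a full polycube in \<open>\<real>\<^sup>n\<close>, but represents \<open>f\<close> only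
  on \<open>A\<close>. So at a boundary point of a relatively open subset \<open>A\<close> of a half-space this says that
  \<open>f\<close> extends to an analytic function on a neighbourhood of \<open>p\<close> in \<open>\<real>\<^sup>n\<close>.
\<close>

definition real_analytic_on :: "nat \<Rightarrow> ((nat \<Rightarrow> real) \<Rightarrow> real) \<Rightarrow> (nat \<Rightarrow> real) set \<Rightarrow> bool" where
  "real_analytic_on n f A \<longleftrightarrow>
     (\<forall>p\<in>A. \<exists>r>0. \<exists>c. \<forall>x. (\<forall>i<n. \<bar>x i - p i\<bar> < r) \<longrightarrow>
        power_series_term n c p x summable_on multi_indices n \<and>
        (x \<in> A \<longrightarrow> (power_series_term n c p x has_sum f x) (multi_indices n)))"


section \<open>Analytic manifolds, analytic maps, Lie groups\<close>

type_synonym 'a chart = "'a set \<times> ('a \<Rightarrow> nat \<Rightarrow> real)"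

record 'a manifold =
  underlying :: "'a topology"
  mdim :: nat
  atlas :: "'a chart set"

abbreviation points :: "'a manifold \<Rightarrow> 'a set" where
  "points X \<equiv> topspace (underlying X)"

definition half_space :: "nat \<Rightarrow> (nat \<Rightarrow> real) topology" where
  "half_space n = subtopology (Euclidean_space n) {x. 0 \<le> x 0}"

definition chart_into :: "(nat \<Rightarrow> real) topology \<Rightarrow> 'a topology \<Rightarrow> 'a chart \<Rightarrow> bool" where
  "chart_into E X = (\<lambda>(U, \<phi>). openin X U \<and> openin E (\<phi> ` U) \<and>
     homeomorphic_map (subtopology X U) (subtopology E (\<phi> ` U)) \<phi>)"

definition analytic_atlas :: "(nat \<Rightarrow> real) topology \<Rightarrow> 'a manifold \<Rightarrow> bool" where
  "analytic_atlas E X \<longleftrightarrow>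
     (\<forall>c\<in>atlas X. chart_into E (underlying X) c) \<and>
     (\<Union>(U, \<phi>)\<in>atlas X. U) = points X \<and>
     (\<forall>(U, \<phi>)\<in>atlas X. \<forall>(V, \<psi>)\<in>atlas X. \<forall>j<mdim X.
        real_analytic_on (mdim X) (\<lambda>x. \<psi> (inv_into U \<phi> x) j) (\<phi> ` (U \<inter> V)))"

definition analytic_manifold :: "'a manifold \<Rightarrow> bool" where
  "analytic_manifold X \<longleftrightarrow>
     Hausdorff_space (underlying X) \<and> analytic_atlas (Euclidean_space (mdim X)) X"

text \<open>
  The boundary may be empty: every point of a manifold without boundary has a chart onto an open
  subset of the interior of the half-space.
\<close>

definition analytic_manifold_with_boundary :: "'a manifold \<Rightarrow> bool" where
  "analytic_manifold_with_boundary X \<longleftrightarrow>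
     Hausdorff_space (underlying X) \<and> analytic_atlas (half_space (mdim X)) X"

definition analytic_map :: "'a manifold \<Rightarrow> 'b manifold \<Rightarrow> ('a \<Rightarrow> 'b) \<Rightarrow> bool" where
  "analytic_map X Y f \<longleftrightarrow>
     continuous_map (underlying X) (underlying Y) f \<and>
     (\<forall>(U, \<phi>)\<in>atlas X. \<forall>(V, \<psi>)\<in>atlas Y. \<forall>j<mdim Y.
        real_analytic_on (mdim X) (\<lambda>x. \<psi> (f (inv_into U \<phi> x)) j) (\<phi> ` (U \<inter> f -` V)))"

text \<open>
  \<open>J\<close> is the Jacobian matrix at \<open>p\<close>. Partial derivatives are taken within the domain, hence are
  one-sided in the direction of coordinate \<open>0\<close> at boundary points of a half-space.
\<close>

definition has_jacobian ::
    "nat \<Rightarrow> nat \<Rightarrow> ((nat \<Rightarrow> real) \<Rightarrow> nat \<Rightarrow> real) \<Rightarrow> (nat \<Rightarrow> nat \<Rightarrow> real) \<Rightarrow>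
     (nat \<Rightarrow> real) \<Rightarrow> (nat \<Rightarrow> real) set \<Rightarrow> bool" where
  "has_jacobian n m F J p A \<longleftrightarrow>
     (\<forall>j<m. \<forall>i<n. ((\<lambda>t. F (p(i := t)) j) has_real_derivative J j i)
        (at (p i) within {t. p(i := t) \<in> A}))"

definition analytic_immersion :: "'a manifold \<Rightarrow> 'b manifold \<Rightarrow> ('a \<Rightarrow> 'b) \<Rightarrow> bool" where
  "analytic_immersion X Y f \<longleftrightarrow>
     analytic_map X Y f \<and>
     (\<forall>(U, \<phi>)\<in>atlas X. \<forall>(V, \<psi>)\<in>atlas Y. \<forall>p\<in>\<phi> ` (U \<inter> f -` V). \<exists>J.
        has_jacobian (mdim X) (mdim Y) (\<lambda>x. \<psi> (f (inv_into U \<phi> x))) J p (\<phi> ` (U \<inter> f -` V)) \<and>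
        (\<forall>v. (\<forall>j<mdim Y. (\<Sum>i<mdim X. J j i * v i) = 0) \<longrightarrow> (\<forall>i<mdim X. v i = 0)))"

text \<open>The second factor is only meant without boundary.\<close>

definition prod_manifold :: "'a manifold \<Rightarrow> 'b manifold \<Rightarrow> ('a \<times> 'b) manifold" where
  "prod_manifold X Y =
     \<lparr>underlying = prod_topology (underlying X) (underlying Y),
      mdim = mdim X + mdim Y,
      atlas = (\<lambda>((U, \<phi>), (V, \<psi>)).
                 (U \<times> V, \<lambda>(x, y) i. if i < mdim X then \<phi> x i else \<psi> y (i - mdim X)))
              ` (atlas X \<times> atlas Y)\<rparr>"

definition lie_group :: "('g, 'b) monoid_scheme \<Rightarrow> 'g manifold \<Rightarrow> bool" where
  "lie_group G L \<longleftrightarrow>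
     group G \<and> analytic_manifold L \<and> points L = carrier G \<and>
     analytic_map (prod_manifold L L) L (\<lambda>(g, h). g \<otimes>\<^bsub>G\<^esub> h) \<and>
     analytic_map L L (\<lambda>g. inv\<^bsub>G\<^esub> g)"


section \<open>Actions\<close>

definition pointwise_continuous_action ::
    "('g, 'b) monoid_scheme \<Rightarrow> 'g manifold \<Rightarrow> 'm manifold \<Rightarrow> ('g \<Rightarrow> 'm \<Rightarrow> 'm) \<Rightarrow> bool" where
  "pointwise_continuous_action G L M \<phi> \<longleftrightarrow>
     group_action G (points M) \<phi> \<and>
     (\<forall>x\<in>points M. continuous_map (underlying L) (underlying M) (\<lambda>g. \<phi> g x))"

text \<open>The condition \<open>|C| \<ge> 2\<close> includes infinite \<open>C\<close>.\<close>

definition non_contractive ::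
    "('g, 'b) monoid_scheme \<Rightarrow> 'm manifold \<Rightarrow> ('g \<Rightarrow> 'm \<Rightarrow> 'm) \<Rightarrow> bool" where
  "non_contractive G M \<phi> \<longleftrightarrow>
     (\<forall>g\<in>carrier G. analytic_map M M (\<phi> g)) \<and>
     (\<forall>C x. C \<subseteq> points M \<and> (\<exists>a\<in>C. \<exists>b\<in>C. a \<noteq> b) \<and> x \<in> points M - C \<longrightarrow>
        (\<exists>U. openin (underlying M) U \<and> x \<in> U \<and> (\<forall>g\<in>carrier G. \<not> \<phi> g ` C \<subseteq> U)))"


section \<open>1-submanifolds and segments\<close>

definition analytic_1_submanifold :: "'m manifold \<Rightarrow> 's manifold \<Rightarrow> ('s \<Rightarrow> 'm) \<Rightarrow> bool" where
  "analytic_1_submanifold M S \<iota> \<longleftrightarrow>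
     analytic_manifold_with_boundary S \<and> mdim S = 1 \<and>
     connected_space (underlying S) \<and> second_countable (underlying S) \<and>
     analytic_immersion S M \<iota> \<and> inj_on \<iota> (points S)"

definition interval_parametrization :: "'s manifold \<Rightarrow> real set \<Rightarrow> (real \<Rightarrow> 's) \<Rightarrow> bool" where
  "interval_parametrization S D \<upsilon> \<longleftrightarrow>
     is_interval D \<and> (\<exists>a\<in>D. \<exists>b\<in>D. a \<noteq> b) \<and> homeomorphic_map (top_of_set D) (underlying S) \<upsilon>"

definition segments :: "'s manifold \<Rightarrow> 's set set" where
  "segments S = {\<Sigma>. connectedin (underlying S) \<Sigma> \<and> (\<exists>a\<in>\<Sigma>. \<exists>b\<in>\<Sigma>. a \<noteq> b)}"

definition seg_interior :: "real set \<Rightarrow> (real \<Rightarrow> 's) \<Rightarrow> 's set \<Rightarrow> 's set" where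
  "seg_interior D \<upsilon> \<Sigma> = \<upsilon> ` interior {t\<in>D. \<upsilon> t \<in> \<Sigma>}"

definition seg_boundary :: "real set \<Rightarrow> (real \<Rightarrow> 's) \<Rightarrow> 's set \<Rightarrow> 's set" where
  "seg_boundary D \<upsilon> \<Sigma> = \<Sigma> - seg_interior D \<upsilon> \<Sigma>"

definition boundary_segment :: "'s manifold \<Rightarrow> 's set \<Rightarrow> 's set \<Rightarrow> bool" where
  "boundary_segment S \<Sigma> \<Sigma>' \<longleftrightarrow>
     \<Sigma>' \<in> segments S \<and> \<Sigma>' \<subseteq> \<Sigma> \<and> connectedin (underlying S) (\<Sigma> - \<Sigma>')"


section \<open>Stabilizers, free segments, decompositions\<close>

definition stab_submfd ::
    "('g, 'b) monoid_scheme \<Rightarrow> ('g \<Rightarrow> 'm \<Rightarrow> 'm) \<Rightarrow> 's manifold \<Rightarrow> ('s \<Rightarrow> 'm) \<Rightarrow> 'g set" where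
  "stab_submfd G \<phi> S \<iota> = (\<Inter>z\<in>points S. stabilizer G \<phi> (\<iota> z))"

definition coset_class ::
    "('g, 'b) monoid_scheme \<Rightarrow> ('g \<Rightarrow> 'm \<Rightarrow> 'm) \<Rightarrow> 's manifold \<Rightarrow> ('s \<Rightarrow> 'm) \<Rightarrow> 'g \<Rightarrow> 'g set" where
  "coset_class G \<phi> S \<iota> g = g <#\<^bsub>G\<^esub> stab_submfd G \<phi> S \<iota>"

text \<open>
  \<open>overlaps \<phi> M S \<iota> g \<Sigma> \<Sigma>'\<close> is the relation \<open>g \<cdot> \<iota>|\<^bsub>\<Sigma>\<^esub> \<sim>\<^sub>\<circ> \<iota>|\<^bsub>\<Sigma>'\<^esub>\<close>. As \<open>\<iota>\<close> is an analytic immersion,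
  its restriction to an open set is an embedding iff it is a topological one.
\<close>

definition overlaps ::
    "('g \<Rightarrow> 'm \<Rightarrow> 'm) \<Rightarrow> 'm manifold \<Rightarrow> 's manifold \<Rightarrow> ('s \<Rightarrow> 'm) \<Rightarrow> 'g \<Rightarrow> 's set \<Rightarrow> 's set \<Rightarrow> bool" where
  "overlaps \<phi> M S \<iota> g \<Sigma> \<Sigma>' \<longleftrightarrow>
     (\<exists>Q Q'. Q \<in> segments S \<and> openin (underlying S) Q \<and> Q \<subseteq> \<Sigma> \<and>
             Q' \<in> segments S \<and> openin (underlying S) Q' \<and> Q' \<subseteq> \<Sigma>' \<and>
             embedding_map (subtopology (underlying S) Q) (underlying M) \<iota> \<and>
             embedding_map (subtopology (underlying S) Q') (underlying M) \<iota> \<and>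
             \<phi> g ` \<iota> ` Q = \<iota> ` Q')"

definition free_segments ::
    "('g, 'b) monoid_scheme \<Rightarrow> ('g \<Rightarrow> 'm \<Rightarrow> 'm) \<Rightarrow> 'm manifold \<Rightarrow> 's manifold \<Rightarrow> ('s \<Rightarrow> 'm) \<Rightarrow> 's set set" where
  "free_segments G \<phi> M S \<iota> =
     {\<Sigma>\<in>segments S. \<forall>g\<in>carrier G. overlaps \<phi> M S \<iota> g \<Sigma> \<Sigma> \<longleftrightarrow> g \<in> stab_submfd G \<phi> S \<iota>}"

definition maximal_free_segments ::
    "('g, 'b) monoid_scheme \<Rightarrow> ('g \<Rightarrow> 'm \<Rightarrow> 'm) \<Rightarrow> 'm manifold \<Rightarrow> 's manifold \<Rightarrow> ('s \<Rightarrow> 'm) \<Rightarrow> 's set set" where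
  "maximal_free_segments G \<phi> M S \<iota> =
     {\<Sigma>\<in>free_segments G \<phi> M S \<iota>. \<forall>\<Sigma>'\<in>free_segments G \<phi> M S \<iota>. \<Sigma> \<subseteq> \<Sigma>' \<longrightarrow> \<Sigma>' = \<Sigma>}"

definition free_submfd ::
    "('g, 'b) monoid_scheme \<Rightarrow> ('g \<Rightarrow> 'm \<Rightarrow> 'm) \<Rightarrow> 'm manifold \<Rightarrow> 's manifold \<Rightarrow> ('s \<Rightarrow> 'm) \<Rightarrow> bool" where
  "free_submfd G \<phi> M S \<iota> \<longleftrightarrow> free_segments G \<phi> M S \<iota> \<noteq> {}"

text \<open>
  \<open>[g]\<close> is a \<open>z\<close>-decomposition with corresponding segments \<open>\<Sigma>\<^sub>-\<close> and \<open>\<Sigma>\<^sub>+\<close>. It is a property of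
  the class of \<open>g\<close>, see \<open>z_decomposition_cong\<close>. The listed conditions on \<open>\<Sigma>\<^sub>-\<close> and \<open>\<Sigma>\<^sub>+\<close> determine
  them from \<open>K\<^sub>-\<close> and \<open>K\<^sub>+\<close>.
\<close>

definition z_decomposition ::
    "('g, 'b) monoid_scheme \<Rightarrow> ('g \<Rightarrow> 'm \<Rightarrow> 'm) \<Rightarrow> 'm manifold \<Rightarrow> 's manifold \<Rightarrow> ('s \<Rightarrow> 'm) \<Rightarrow>
     real set \<Rightarrow> (real \<Rightarrow> 's) \<Rightarrow> 's \<Rightarrow> 'g \<Rightarrow> 's set \<Rightarrow> 's set \<Rightarrow> bool" where
  "z_decomposition G \<phi> M S \<iota> D \<upsilon> z g \<Sigma>m \<Sigma>p \<longleftrightarrow>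
     g \<in> stabilizer G \<phi> (\<iota> z) \<and>
     coset_class G \<phi> S \<iota> g \<noteq> coset_class G \<phi> S \<iota> \<one>\<^bsub>G\<^esub> \<and>
     (\<exists>Km Kp.
        Km \<in> segments S \<and> compactin (underlying S) Km \<and>
        Kp \<in> segments S \<and> compactin (underlying S) Kp \<and>
        \<phi> g ` \<iota> ` Km = \<iota> ` Kp \<and> Km \<inter> Kp = {z} \<and>
        boundary_segment S (points S) \<Sigma>m \<and> boundary_segment S (points S) \<Sigma>p \<and>
        points S = \<Sigma>m \<union> \<Sigma>p \<and>
        \<Sigma>m \<inter> \<Sigma>p = {z} \<and> seg_boundary D \<upsilon> \<Sigma>m \<inter> seg_boundary D \<upsilon> \<Sigma>p = {z} \<and>
        Km \<subseteq> \<Sigma>m \<and> Kp \<subseteq> \<Sigma>p \<and>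
        \<Sigma>m \<in> free_segments G \<phi> M S \<iota> \<and> \<Sigma>p \<in> free_segments G \<phi> M S \<iota>)"

lemma z_decomposition_cong_aux:
  assumes act: "group_action G (points M) \<phi>" and \<iota>: "\<iota> ` points S \<subseteq> points M"
    and z: "z \<in> points S" and g: "g \<in> carrier G" and g': "g' \<in> carrier G"
    and eq: "coset_class G \<phi> S \<iota> g = coset_class G \<phi> S \<iota> g'"
    and dec: "z_decomposition G \<phi> M S \<iota> D \<upsilon> z g \<Sigma>m \<Sigma>p"
  shows "z_decomposition G \<phi> M S \<iota> D \<upsilon> z g' \<Sigma>m \<Sigma>p"
proof -
  interpret group_action G "points M" \<phi> by (fact act)
  interpret group G using group_hom group_hom.axioms(1) by blast
  have "\<phi> \<one>\<^bsub>G\<^esub> (\<iota> x) = \<iota> x" if "x \<in> points S" for x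
    using that \<iota> id_eq_one by (metis image_subset_iff restrict_apply')
  hence "\<one>\<^bsub>G\<^esub> \<in> stab_submfd G \<phi> S \<iota>"
    by (auto simp: stab_submfd_def stabilizer_def)
  hence "g' \<in> coset_class G \<phi> S \<iota> g"
    unfolding eq using g' by (force simp: coset_class_def l_coset_def)
  then obtain s where s: "s \<in> stab_submfd G \<phi> S \<iota>" "g' = g \<otimes>\<^bsub>G\<^esub> s"
    by (auto simp: coset_class_def l_coset_def)
  have pt: "\<phi> g' (\<iota> x) = \<phi> g (\<iota> x)" if "x \<in> points S" for x
  proof -
    have "s \<in> stabilizer G \<phi> (\<iota> x)" using s that by (auto simp: stab_submfd_def)
    hence "s \<in> carrier G" "\<phi> s (\<iota> x) = \<iota> x" by (auto simp: stabilizer_def)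
    thus ?thesis using composition_rule[of "\<iota> x" g s] \<iota> that g s by auto
  qed
  have "\<phi> g' ` \<iota> ` K = \<phi> g ` \<iota> ` K" if "K \<in> segments S" for K
    using that pt by (force simp: segments_def connectedin_def image_image intro!: image_cong)
  thus ?thesis
    using dec pt[OF z] g' eq unfolding z_decomposition_def stabilizer_def by auto
qed

lemma z_decomposition_cong:
  assumes "group_action G (points M) \<phi>" "\<iota> ` points S \<subseteq> points M" "z \<in> points S"
    and "g \<in> carrier G" "g' \<in> carrier G"
    and "coset_class G \<phi> S \<iota> g = coset_class G \<phi> S \<iota> g'"
  shows "z_decomposition G \<phi> M S \<iota> D \<upsilon> z g \<Sigma>m \<Sigma>p \<longleftrightarrow> z_decomposition G \<phi> M S \<iota> D \<upsilon> z g' \<Sigma>m \<Sigma>p"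
  using z_decomposition_cong_aux[OF assms(1-3)] assms(4-) by metis

end

theory Submission
  imports Defs "HOL-Complex_Analysis.Complex_Analysis"
begin

text \<open>
  Write \<open>\<gamma> = \<iota> \<circ> \<upsilon>\<close>. In charts, \<open>g \<cdot> \<gamma>\<close> and \<open>\<gamma>\<close> extend to holomorphic curves, and \<open>\<gamma>\<close> is immersed, so
  the inverse function theorem and the identity theorem show: as soon as the pairs \<open>(t, s)\<close> with
  \<open>g \<cdot> \<gamma>(t) = \<gamma>(s)\<close> accumulate at an interior pair, they form near it the graph of a continuous
  injection defined on a full neighbourhood. Hence overlaps continue analytically until one of the
  two parameters leaves \<open>D\<close>.

  If \<open>[g]\<close> is a \<open>z\<close>-decomposition, then \<open>g \<cdot> \<gamma>\<close> overlaps \<open>\<gamma>\<close> through \<open>z\<close>. As the two halves are free,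
  the overlap exchanges the sides of \<open>z\<close>, so \<open>g\<^sup>2\<close> fixes \<open>S\<close>, and no free segment contains \<open>z\<close> in its
  interior. If \<open>h\<close> carries a point \<open>\<gamma>(t)\<close> of one half to a point \<open>\<gamma>(s)\<close> of the other one, continuation
  of the overlap of \<open>g\<close> from \<open>z\<close> reaches \<open>s\<close> or \<open>t\<close>. So \<open>g h\<close> or \<open>h g\<close> overlaps one half with itself
  and fixes \<open>S\<close>, which gives \<open>[h] = [g]\<close>.
\<close>

section \<open>Complexification of real analytic functions\<close>

text \<open>Near \<open>w\<close> the values \<open>f i u\<close> stay below \<open>r / 2\<close> in
  norm, so the terms of the real series at the point \<open>p\<close> shifted by
  \<open>r / 2\<close> in every coordinate dominate the complex terms. By the Weierstrass M-test the
  sum is a uniform limit of holomorphic finite sums on a closed ball.\<close>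

lemma power_series_compose_analytic:
  fixes f :: "nat \<Rightarrow> complex \<Rightarrow> complex"
  assumes "r > 0"
    and sm: "\<And>x. (\<And>i. i < n \<Longrightarrow> \<bar>x i - p i\<bar> < r) \<Longrightarrow> power_series_term n c p x summable_on multi_indices n"
    and f: "\<And>i. i < n \<Longrightarrow> f i analytic_on {w}" "\<And>i. i < n \<Longrightarrow> f i w = 0"
  shows "(\<lambda>w. \<Sum>\<^sub>\<infinity>\<alpha>\<in>multi_indices n. of_real (c \<alpha>) * (\<Prod>i<n. f i w ^ \<alpha> i)) analytic_on {w}"
    (is "?F analytic_on _")
proof -
  \<comment> \<open>Radii are collected as a filter statement, so that finitely many conditions
    combine into one common radius, also for \<open>n = 0\<close>.\<close>
  have "\<forall>\<^sub>F e in at_right 0. f i holomorphic_on ball w e \<and> (\<forall>u\<in>ball w e. norm (f i u) < r / 2)"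
    if i: "i < n" for i
  proof -
    obtain d where d: "d > 0" "f i holomorphic_on ball w d"
      using f(1)[OF i] by (auto simp: analytic_at_ball)
    have "isCont (f i) w"
      using f(1)[OF i] by (rule analytic_at_imp_isCont)
    then obtain d' where d': "d' > 0" "\<And>u. dist u w < d' \<Longrightarrow> norm (f i u) < r / 2"
      using \<open>r > 0\<close> f(2)[OF i] unfolding continuous_at_eps_delta
      by (metis dist_0_norm dist_commute half_gt_zero)
    have "\<forall>\<^sub>F e in at_right 0. e < min d d'"
      using d d' by (auto simp: eventually_at_right_field intro!: exI[of _ "min d d'"])
    thus ?thesis
    proof eventually_elim
      case (elim e)
      have "ball w e \<subseteq> ball w d" using elim by auto
      thus ?case using d d' elim by (auto simp: dist_commute intro: holomorphic_on_subset)
    qed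
  qed
  hence "\<forall>\<^sub>F e in at_right 0. \<forall>i\<in>{..<n}. f i holomorphic_on ball w e \<and> (\<forall>u\<in>ball w e. norm (f i u) < r / 2)"
    by (intro eventually_ball_finite) auto
  moreover have "\<forall>\<^sub>F e in at_right (0::real). e > 0" by (rule eventually_at_right_less)
  ultimately have "\<forall>\<^sub>F e in at_right 0. e > 0 \<and>
      (\<forall>i\<in>{..<n}. f i holomorphic_on ball w e \<and> (\<forall>u\<in>ball w e. norm (f i u) < r / 2))"
    by eventually_elim auto
  from eventually_happens'[OF trivial_limit_at_right_real this]
  obtain e where e': "e > 0 \<and>
      (\<forall>i\<in>{..<n}. f i holomorphic_on ball w e \<and> (\<forall>u\<in>ball w e. norm (f i u) < r / 2))" ..
  have e: "f i holomorphic_on ball w e" "u \<in> ball w e \<Longrightarrow> norm (f i u) < r / 2" if "i < n" for i u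
    using e'[THEN conjunct2, THEN bspec, of i] that by blast+
  from e' have "e > 0" ..
  define m where "m = (\<lambda>\<alpha>. \<bar>c \<alpha>\<bar> * (\<Prod>i<n. (r / 2) ^ \<alpha> i))"
  have "power_series_term n c p (\<lambda>i. p i + r / 2) summable_on multi_indices n"
    using \<open>r > 0\<close> by (intro sm) auto
  \<comment> \<open>Summability of reals is absolute, so the convergence assumed in
    \<open>sm\<close> already provides the majorant \<open>m\<close>.\<close>
  hence "(\<lambda>\<alpha>. norm (power_series_term n c p (\<lambda>i. p i + r / 2) \<alpha>)) summable_on multi_indices n"
    by (rule summable_on_iff_abs_summable_on_real[THEN iffD1])
  also have "(\<lambda>\<alpha>. norm (power_series_term n c p (\<lambda>i. p i + r / 2) \<alpha>)) = m"
    using \<open>r > 0\<close> by (auto simp: m_def power_series_term_def abs_mult abs_prod power_abs)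
  finally have m: "m summable_on multi_indices n" .
  have ulim: "uniform_limit (cball w (e / 2))
          (\<lambda>X u. \<Sum>\<alpha>\<in>X. of_real (c \<alpha>) * (\<Prod>i<n. f i u ^ \<alpha> i)) ?F
          (finite_subsets_at_top (multi_indices n))"
  proof (rule Weierstrass_m_test_general)
    fix \<alpha> u assume u: "u \<in> cball w (e / 2)"
    have "norm (f i u) \<le> r / 2" if "i < n" for i
      using e(2)[OF that, of u] u \<open>e > 0\<close> by simp
    hence "(\<Prod>i<n. norm (f i u) ^ \<alpha> i) \<le> (\<Prod>i<n. (r / 2) ^ \<alpha> i)"
      by (intro prod_mono) (auto intro!: power_mono)
    thus "norm (of_real (c \<alpha>) * (\<Prod>i<n. f i u ^ \<alpha> i)) \<le> m \<alpha>"
      by (simp add: m_def norm_mult norm_power prod_norm [symmetric] mult_left_mono)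
  qed (rule m)
  have cont: "continuous_on (cball w (e / 2)) (\<lambda>u. \<Sum>\<alpha>\<in>X. of_real (c \<alpha>) * (\<Prod>i<n. f i u ^ \<alpha> i)) \<and>
      (\<lambda>u. \<Sum>\<alpha>\<in>X. of_real (c \<alpha>) * (\<Prod>i<n. f i u ^ \<alpha> i)) holomorphic_on ball w (e / 2)" for X
  proof -
    have hol: "(\<lambda>u. \<Sum>\<alpha>\<in>X. of_real (c \<alpha>) * (\<Prod>i<n. f i u ^ \<alpha> i)) holomorphic_on ball w e"
      using e(1) by (intro holomorphic_intros) auto
    have "cball w (e / 2) \<subseteq> ball w e" "ball w (e / 2) \<subseteq> ball w e" using \<open>e > 0\<close> by auto
    thus ?thesis
      using holomorphic_on_subset[OF hol] holomorphic_on_imp_continuous_on by blast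
  qed
  have "?F holomorphic_on ball w (e / 2)"
    by (rule holomorphic_uniform_limit[OF always_eventually[OF allI[OF cont]] ulim]) simp
  thus ?thesis unfolding analytic_at_ball using \<open>e > 0\<close> by (intro exI[of _ "e / 2"]) simp
qed

text \<open>\<open>E\<close> is the power series of \<open>F\<close> with the holomorphic functions
  \<open>f i\<close> substituted for the coordinates. It can be compared with \<open>F\<close> only
  at arguments \<open>u\<close> where the \<open>f i\<close> take the coordinates of a point of
  \<open>A\<close> near \<open>p\<close> as values.\<close>

lemma real_analytic_on_compose_analytic:
  fixes f :: "nat \<Rightarrow> complex \<Rightarrow> complex"
  assumes F: "real_analytic_on n F A" and p: "p \<in> A"
    and f: "\<And>i. i < n \<Longrightarrow> f i analytic_on {w}" "\<And>i. i < n \<Longrightarrow> f i w = of_real (p i)"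
  obtains r E where "r > 0" "E analytic_on {w}"
    "\<forall>u. \<forall>x\<in>A. (\<forall>i<n. f i u = of_real (x i) \<and> \<bar>x i - p i\<bar> < r) \<longrightarrow> E u = of_real (F x)"
proof -
  obtain r c where r: "r > 0"
    and c: "\<And>x. (\<And>i. i < n \<Longrightarrow> \<bar>x i - p i\<bar> < r) \<Longrightarrow>
        power_series_term n c p x summable_on multi_indices n \<and>
        (x \<in> A \<longrightarrow> (power_series_term n c p x has_sum F x) (multi_indices n))"
    using F p unfolding real_analytic_on_def by meson
  define E where "E = (\<lambda>u. \<Sum>\<^sub>\<infinity>\<alpha>\<in>multi_indices n. of_real (c \<alpha>) * (\<Prod>i<n. (f i u - of_real (p i)) ^ \<alpha> i))"
  show thesis
  proof (rule that[OF r])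
    show "E analytic_on {w}"
      unfolding E_def using r c f
      by (intro power_series_compose_analytic[where r = r and p = p]) (auto intro!: analytic_intros)
  next
    show "\<forall>u. \<forall>x\<in>A. (\<forall>i<n. f i u = of_real (x i) \<and> \<bar>x i - p i\<bar> < r) \<longrightarrow> E u = of_real (F x)"
    proof (intro allI ballI impI)
      fix u x
      assume x: "x \<in> A" and fx: "\<forall>i<n. f i u = of_real (x i) \<and> \<bar>x i - p i\<bar> < r"
      have eq: "of_real (power_series_term n c p x \<alpha>) =
          of_real (c \<alpha>) * (\<Prod>i<n. (f i u - of_real (p i)) ^ \<alpha> i)" for \<alpha>
        using fx by (simp add: power_series_term_def)
      have "((\<lambda>\<alpha>. of_real (power_series_term n c p x \<alpha>) :: complex) has_sum of_real (F x)) (multi_indices n)"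
        using c x fx by (intro has_sum_of_real) auto
      thus "E u = of_real (F x)"
        unfolding eq E_def by (rule infsumI)
    qed
  qed
qed

section \<open>Coincidence of two analytic curves\<close>

text \<open>Invariance of domain in dimension one: the image of the ball is open.\<close>

lemma continuous_inj_image_nhds:
  fixes c :: "real \<Rightarrow> real"
  assumes "d > 0" "continuous_on (ball s d) c" "inj_on c (ball s d)"
  shows "\<forall>\<^sub>F y in nhds (c s). \<exists>x\<in>ball s d. c x = y"
proof -
  have "open (c ` ball s d)"
    using assms by (intro injective_into_1d_imp_open_map_UNIV) auto
  thus ?thesis
    using assms(1) by (auto simp: eventually_nhds intro!: exI[of _ "c ` ball s d"])
qed

text \<open>
  Inverting a component of the second curve, which is immersed at \<open>s\<^sub>0\<close>, turns a coincidence along a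
  sequence into an identity between holomorphic functions. The local parameters \<open>h\<close> and \<open>k\<close> need
  not be analytic.
\<close>

lemma analytic_curves_coincide:
  fixes h k :: "real \<Rightarrow> real" and e c :: "nat \<Rightarrow> real \<Rightarrow> real" and E C :: "nat \<Rightarrow> complex \<Rightarrow> complex"
  assumes h: "d > 0" "continuous_on (ball t\<^sub>0 d) h" "inj_on h (ball t\<^sub>0 d)"
    and k: "d > 0" "continuous_on (ball s\<^sub>0 d) k" "inj_on k (ball s\<^sub>0 d)"
    and E: "\<And>j. j < n \<Longrightarrow> E j analytic_on {of_real (h t\<^sub>0)}"
      "\<And>j t. j < n \<Longrightarrow> t \<in> ball t\<^sub>0 d \<Longrightarrow> E j (of_real (h t)) = of_real (e j t)"
    and C: "\<And>j. j < n \<Longrightarrow> C j analytic_on {of_real (k s\<^sub>0)}"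
      "\<And>j s. j < n \<Longrightarrow> s \<in> ball s\<^sub>0 d \<Longrightarrow> C j (of_real (k s)) = of_real (c j s)"
    and imm: "l < n" "deriv (C l) (of_real (k s\<^sub>0)) \<noteq> 0"
    and eq0: "\<And>j. j < n \<Longrightarrow> e j t\<^sub>0 = c j s\<^sub>0"
    and acc: "\<And>\<epsilon>. \<epsilon> > 0 \<Longrightarrow> \<exists>t\<in>ball t\<^sub>0 \<epsilon>. \<exists>s\<in>ball s\<^sub>0 \<epsilon>. t \<noteq> t\<^sub>0 \<and> (\<forall>j<n. e j t = c j s)"
    and "\<delta> > 0"
  shows "\<forall>\<^sub>F t in nhds t\<^sub>0. \<exists>s\<in>ball s\<^sub>0 \<delta>. \<forall>j<n. e j t = c j s"
proof -
  define a b where "a = complex_of_real (h t\<^sub>0)" and "b = complex_of_real (k s\<^sub>0)"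
  obtain X where X: "open X" "b \<in> X" "C l holomorphic_on X"
    using C(1)[OF imm(1)] by (auto simp: analytic_at b_def)
  \<comment> \<open>The component \<open>l\<close> has nonzero derivative and is invertible near
    \<open>b\<close>; \<open>I\<close> below is its holomorphic inverse.\<close>
  obtain r where r: "r > 0" "ball b r \<subseteq> X" "open (C l ` ball b r)" "inj_on (C l) (ball b r)"
    using has_complex_derivative_locally_invertible[OF X(3,2,1)] imm(2) by (auto simp: b_def)
  have "C l holomorphic_on ball b r" using X(3) r(2) by (rule holomorphic_on_subset)
  then obtain I where I: "I holomorphic_on C l ` ball b r" "\<And>z. z \<in> ball b r \<Longrightarrow> I (C l z) = z"
    using holomorphic_has_inverse[OF _ _ r(4)] by (metis open_ball)
  have b: "b \<in> ball b r" using r by auto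
  have Cb: "E l a = C l b"
    using E(2)[OF imm(1), of t\<^sub>0] C(2)[OF imm(1), of s\<^sub>0] eq0[OF imm(1)] h(1) by (simp add: a_def b_def)
  \<comment> \<open>The holomorphic change of parameter: at a coincidence close to the base points,
    \<open>T\<close> sends \<open>h t\<close> to \<open>k s\<close>.\<close>
  define T where "T = I \<circ> E l"
  have T: "T analytic_on {a}" unfolding T_def
  proof (rule analytic_on_compose)
    show "E l analytic_on {a}" using E(1)[OF imm(1)] by (simp add: a_def)
    show "I analytic_on E l ` {a}"
      unfolding image_insert image_empty Cb analytic_at using I(1) r(3) b by blast
  qed
  have Ta: "T a = b" using I(2)[OF b] Cb by (simp add: T_def)
  have Z: "(\<lambda>u. E j u - (C j \<circ> T) u) analytic_on {a}" if "j < n" for j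
    using T Ta E(1) C(1) that
    by (intro analytic_on_diff analytic_on_compose) (auto simp: a_def b_def)

  have ht: "h \<midarrow>t\<^sub>0\<rightarrow> h t\<^sub>0" and ks: "k \<midarrow>s\<^sub>0\<rightarrow> k s\<^sub>0"
    using h k by (auto simp: continuous_on_eq_continuous_at isCont_def)
  have hn: "(h \<longlongrightarrow> h t\<^sub>0) (nhds t\<^sub>0)" and kn: "(k \<longlongrightarrow> k s\<^sub>0) (nhds s\<^sub>0)"
    using ht ks by (simp_all add: tendsto_at_iff_tendsto_nhds)
  have kr: "\<forall>\<^sub>F s in nhds s\<^sub>0. complex_of_real (k s) \<in> ball b r"
    using tendstoD[OF kn r(1)] by eventually_elim (simp add: b_def dist_commute)
  then obtain d' where d': "d' > 0" "\<And>s. s \<in> ball s\<^sub>0 d' \<Longrightarrow> complex_of_real (k s) \<in> ball b r"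
    by (auto simp: eventually_nhds_metric dist_commute)

  have zero: "\<forall>\<^sub>F u in nhds a. E j u = C j (T u)" if j: "j < n" for j
  proof -
    obtain \<rho> where \<rho>: "\<rho> > 0" "(\<lambda>u. E j u - (C j \<circ> T) u) holomorphic_on ball a \<rho>"
      using Z[OF j] by (auto simp: analytic_on_def)
    define U where "U = {u \<in> ball a \<rho>. E j u - (C j \<circ> T) u = 0}"
    \<comment> \<open>Coincidences with \<open>t \<noteq> t\<^sub>0\<close> give zeros different
      from \<open>a\<close> because \<open>h\<close> is injective, so the identity theorem
      applies.\<close>
    have lim: "a islimpt U"
      unfolding islimpt_approachable
    proof (intro allI impI)
      fix \<epsilon> :: real assume "\<epsilon> > 0"
      have "\<forall>\<^sub>F t in nhds t\<^sub>0. dist (h t) (h t\<^sub>0) < min \<epsilon> \<rho>"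
        using \<open>\<epsilon> > 0\<close> \<rho>(1) by (intro tendstoD[OF hn]) simp
      then obtain d'' where d'': "d'' > 0" "\<And>t. t \<in> ball t\<^sub>0 d'' \<Longrightarrow> dist (h t) (h t\<^sub>0) < min \<epsilon> \<rho>"
        by (auto simp: eventually_nhds_metric dist_commute)
      obtain t s where ts: "t \<in> ball t\<^sub>0 (min d (min d' d''))" "s \<in> ball s\<^sub>0 (min d (min d' d''))"
         "t \<noteq> t\<^sub>0" "\<And>j. j < n \<Longrightarrow> e j t = c j s"
        using acc[of "min d (min d' d'')"] h(1) d' d'' by auto
      have "E l (of_real (h t)) = C l (of_real (k s))"
        using ts E(2) C(2) imm(1) by auto
      hence "T (of_real (h t)) = of_real (k s)"
        using I(2)[OF d'(2), of s] ts by (simp add: T_def)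
      hence "E j (of_real (h t)) - (C j \<circ> T) (of_real (h t)) = 0"
        using ts E(2) C(2) j by auto
      moreover have "dist (complex_of_real (h t)) a < min \<epsilon> \<rho>"
        using d''(2)[of t] ts by (simp add: a_def)
      moreover have "complex_of_real (h t) \<noteq> a"
        using h(1,3) ts unfolding a_def by (auto simp: inj_on_def)
      ultimately show "\<exists>x'\<in>U. x' \<noteq> a \<and> dist x' a < \<epsilon>"
        by (auto simp: U_def dist_commute)
    qed
    have eq: "E j u - (C j \<circ> T) u = 0" if "u \<in> ball a \<rho>" for u
    proof (rule analytic_continuation[OF \<rho>(2) open_ball connected_ball _ _ lim])
      show "U \<subseteq> ball a \<rho>" by (auto simp: U_def)
      show "a \<in> ball a \<rho>" using \<rho>(1) by simp
      show "E j v - (C j \<circ> T) v = 0" if "v \<in> U" for v using that by (simp add: U_def)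
    qed (rule that)
    have "\<forall>\<^sub>F u in nhds a. u \<in> ball a \<rho>" using \<rho>(1) by (intro eventually_nhds_in_open) auto
    thus ?thesis by eventually_elim (use eq in simp)
  qed
  have "\<forall>\<^sub>F u in nhds a. \<forall>j\<in>{..<n}. E j u = C j (T u)"
    using zero by (intro eventually_ball_finite) auto
  moreover have "((\<lambda>t. complex_of_real (h t)) \<longlongrightarrow> a) (nhds t\<^sub>0)"
    unfolding a_def by (intro tendsto_of_real hn)
  ultimately have 1: "\<forall>\<^sub>F t in nhds t\<^sub>0. \<forall>j\<in>{..<n}. E j (of_real (h t)) = C j (T (of_real (h t)))"
    by (rule eventually_compose_filterlim)

  have near: "\<forall>\<^sub>F t in nhds t\<^sub>0. t \<in> ball t\<^sub>0 d"
    using h(1) by (intro eventually_nhds_in_open) auto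
  \<comment> \<open>Small enough for the formulas for \<open>C\<close> (\<open>d\<close>), for the
    injectivity of \<open>C l\<close> (\<open>d'\<close>) and for the bound asked for
    (\<open>\<delta>\<close>).\<close>
  define \<eta> where "\<eta> = Min {d, d', \<delta>}"
  have \<eta>: "\<eta> > 0" "\<eta> \<le> d" "\<eta> \<le> d'" "\<eta> \<le> \<delta>" using h(1) d'(1) \<open>\<delta> > 0\<close> by (auto simp: \<eta>_def)
  have cl: "c l s = Re (C l (of_real (k s)))" if "s \<in> ball s\<^sub>0 d" for s
    using C(2)[OF imm(1) that] by simp
  have "continuous_on (ball s\<^sub>0 \<eta>) (\<lambda>s. Re (C l (of_real (k s))))"
  proof (intro continuous_on_Re continuous_on_compose2[where g = "C l" and s = "ball s\<^sub>0 \<eta>"])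
    show "continuous_on (ball b r) (C l)"
      using \<open>C l holomorphic_on ball b r\<close> by (rule holomorphic_on_imp_continuous_on)
    show "continuous_on (ball s\<^sub>0 \<eta>) (\<lambda>s. complex_of_real (k s))"
      using k(2) \<eta>(2) by (intro continuous_on_of_real) (auto elim: continuous_on_subset)
    show "(\<lambda>x. complex_of_real (k x)) ` ball s\<^sub>0 \<eta> \<subseteq> ball b r" using d' \<eta> by auto
  qed
  hence cont: "continuous_on (ball s\<^sub>0 \<eta>) (c l)"
    using \<eta>(2) by (subst continuous_on_cong[OF refl cl]) auto
  have "inj_on (c l) (ball s\<^sub>0 \<eta>)"
  proof (rule inj_onI)
    fix x y assume xy: "x \<in> ball s\<^sub>0 \<eta>" "y \<in> ball s\<^sub>0 \<eta>" "c l x = c l y"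
    hence "x \<in> ball s\<^sub>0 d" "y \<in> ball s\<^sub>0 d" "complex_of_real (k x) \<in> ball b r" "complex_of_real (k y) \<in> ball b r"
      using \<eta> d'(2) by auto
    moreover from this have "C l (of_real (k x)) = C l (of_real (k y))" using C(2)[OF imm(1)] xy(3) by simp
    ultimately have "k x = k y" using r(4) by (auto dest: inj_onD)
    thus "x = y" using \<open>x \<in> ball s\<^sub>0 d\<close> \<open>y \<in> ball s\<^sub>0 d\<close> k(3) by (auto dest: inj_onD)
  qed
  \<comment> \<open>The parameter \<open>s\<close> is found from the component \<open>l\<close>
    alone, which is an open map on the ball. The other components then agree because
    \<open>E j\<close> equals \<open>C j \<circ> T\<close> near \<open>a\<close>.\<close>
  hence "\<forall>\<^sub>F y in nhds (c l s\<^sub>0). \<exists>x\<in>ball s\<^sub>0 \<eta>. c l x = y"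
    using continuous_inj_image_nhds \<eta>(1) cont by blast
  moreover have "((\<lambda>t. e l t) \<longlongrightarrow> c l s\<^sub>0) (nhds t\<^sub>0)"
  proof -
    have "isCont (E l) a"
      using E(1)[OF imm(1)] by (auto simp: a_def intro: analytic_at_imp_isCont)
    hence "((\<lambda>t. Re (E l (of_real (h t)))) \<longlongrightarrow> Re (E l a)) (nhds t\<^sub>0)"
      using \<open>((\<lambda>t. complex_of_real (h t)) \<longlongrightarrow> a) (nhds t\<^sub>0)\<close>
      by (rule tendsto_Re[OF isCont_tendsto_compose])
    moreover have "Re (E l a) = c l s\<^sub>0"
      using E(2)[OF imm(1), of t\<^sub>0] eq0[OF imm(1)] h(1) by (simp add: a_def)
    moreover have "\<forall>\<^sub>F t in nhds t\<^sub>0. Re (E l (of_real (h t))) = e l t"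
      using near by eventually_elim (use E(2)[OF imm(1)] in simp)
    ultimately show ?thesis by (auto elim: Lim_transform_eventually)
  qed
  ultimately have 2: "\<forall>\<^sub>F t in nhds t\<^sub>0. \<exists>s\<in>ball s\<^sub>0 \<eta>. c l s = e l t"
    by (rule eventually_compose_filterlim)
  from 1 2 near show ?thesis
  proof eventually_elim
    case (elim t)
    then obtain s where s: "s \<in> ball s\<^sub>0 \<eta>" "c l s = e l t" by blast
    have "T (of_real (h t)) = of_real (k s)"
      using I(2)[OF d'(2), of s] s \<eta> elim E(2)[OF imm(1), of t] C(2)[OF imm(1), of s] by (simp add: T_def)
    hence "e j t = c j s" if "j < n" for j
      using elim(1,3) E(2)[OF that, of t] C(2)[OF that, of s] that s \<eta> by simp
    thus ?case using s \<eta> by (intro bexI[of _ s]) auto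
  qed
qed

section \<open>The curve and its translates in charts\<close>

lemma eventually_continuous_map_interior:
  fixes D :: "real set"
  assumes "continuous_map (top_of_set D) X f" "openin X V" "t \<in> interior D" "f t \<in> V"
  shows "\<forall>\<^sub>F u in nhds t. u \<in> interior D \<and> f u \<in> V"
proof -
  have "openin (top_of_set D) {u \<in> D. f u \<in> V}"
    using openin_continuous_map_preimage[OF assms(1,2)] by simp
  then obtain T where T: "open T" "{u \<in> D. f u \<in> V} = D \<inter> T" by (auto simp: openin_open)
  have "t \<in> D" using assms(3) interior_subset by blast
  hence "t \<in> T" using T(2) assms(4) by blast
  hence "\<forall>\<^sub>F u in nhds t. u \<in> interior D \<and> u \<in> T"
    using T(1) assms(3) by (intro eventually_conj eventually_nhds_in_open) auto
  thus ?thesis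
    by eventually_elim (use T(2) interior_subset[of D] in blast)
qed

lemma topspace_half_space: "x \<in> topspace (half_space n) \<Longrightarrow> i \<ge> n \<Longrightarrow> x i = 0"
  by (auto simp: half_space_def topspace_Euclidean_space)

lemma continuous_map_Euclidean_space_coordinate:
  "continuous_map (Euclidean_space n) euclideanreal (\<lambda>x. x i)"
  unfolding Euclidean_space_def
  by (intro continuous_map_from_subtopology continuous_map_product_projection) auto

lemma continuous_map_half_space_coordinate:
  "continuous_map (half_space n) euclideanreal (\<lambda>x. x i)"
  unfolding half_space_def
  by (intro continuous_map_from_subtopology continuous_map_Euclidean_space_coordinate)

locale curve_action =
  fixes G :: "('g, 'b) monoid_scheme" and M :: "'m manifold" and \<phi> :: "'g \<Rightarrow> 'm \<Rightarrow> 'm"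
    and S :: "'s manifold" and \<iota> :: "'s \<Rightarrow> 'm" and D :: "real set" and \<upsilon> :: "real \<Rightarrow> 's"
  assumes action: "group_action G (points M) \<phi>"
    and manifold: "analytic_manifold M"
    and analytic_action: "g \<in> carrier G \<Longrightarrow> analytic_map M M (\<phi> g)"
    and submanifold: "analytic_1_submanifold M S \<iota>"
    and parametrization: "interval_parametrization S D \<upsilon>"
begin

definition \<gamma> :: "real \<Rightarrow> 'm" where "\<gamma> t = \<iota> (\<upsilon> t)"

lemma homeo: "homeomorphic_map (top_of_set D) (underlying S) \<upsilon>"
  using parametrization by (simp add: interval_parametrization_def)

lemma continuous_map_\<upsilon>: "continuous_map (top_of_set D) (underlying S) \<upsilon>"
  using homeo by (rule homeomorphic_imp_continuous_map)

lemma inj_\<upsilon>: "inj_on \<upsilon> D"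
  using homeo homeomorphic_imp_injective_map by fastforce

lemma image_\<upsilon>: "\<upsilon> ` D = points S"
  using homeo homeomorphic_imp_surjective_map by fastforce

lemma continuous_map_\<iota>: "continuous_map (underlying S) (underlying M) \<iota>"
  using submanifold by (simp add: analytic_1_submanifold_def analytic_immersion_def analytic_map_def)

lemma inj_\<iota>: "inj_on \<iota> (points S)"
  using submanifold by (simp add: analytic_1_submanifold_def)

lemma Hausdorff: "Hausdorff_space (underlying M)"
  using manifold by (simp add: analytic_manifold_def)

lemma continuous_map_\<gamma>: "continuous_map (top_of_set D) (underlying M) \<gamma>"
  using continuous_map_compose[OF continuous_map_\<upsilon> continuous_map_\<iota>]
  by (simp add: \<gamma>_def[abs_def] o_def)

lemma inj_\<gamma>: "inj_on \<gamma> D"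
  using comp_inj_on[OF inj_\<upsilon>] inj_\<iota> image_\<upsilon> by (simp add: \<gamma>_def[abs_def] o_def)

lemma \<gamma>_in: "t \<in> D \<Longrightarrow> \<gamma> t \<in> points M"
  using continuous_map_image_subset_topspace[OF continuous_map_\<gamma>] by auto

lemma continuous_map_action:
  "g \<in> carrier G \<Longrightarrow> continuous_map (underlying M) (underlying M) (\<phi> g)"
  using analytic_action by (simp add: analytic_map_def)

lemma continuous_map_\<phi>\<gamma>:
  "g \<in> carrier G \<Longrightarrow> continuous_map (top_of_set D) (underlying M) (\<lambda>t. \<phi> g (\<gamma> t))"
  using continuous_map_compose[OF continuous_map_\<gamma> continuous_map_action] by (simp add: o_def)

lemma inj_action: "g \<in> carrier G \<Longrightarrow> inj_on (\<phi> g) (points M)"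
  using action by (rule group_action.inj_prop)

lemma inj_\<phi>\<gamma>: "g \<in> carrier G \<Longrightarrow> inj_on (\<lambda>t. \<phi> g (\<gamma> t)) D"
  using inj_action inj_\<gamma> \<gamma>_in by (fastforce simp: inj_on_def)

lemma chart_M:
  assumes "(V, \<psi>) \<in> atlas M"
  shows "openin (underlying M) V" "inj_on \<psi> V" "\<And>x i. x \<in> V \<Longrightarrow> i \<ge> mdim M \<Longrightarrow> \<psi> x i = 0"
proof -
  have c: "chart_into (Euclidean_space (mdim M)) (underlying M) (V, \<psi>)"
    using assms manifold by (auto simp: analytic_manifold_def analytic_atlas_def)
  thus V: "openin (underlying M) V" by (simp add: chart_into_def)
  have h: "homeomorphic_map (subtopology (underlying M) V)
      (subtopology (Euclidean_space (mdim M)) (\<psi> ` V)) \<psi>"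
    using c by (simp add: chart_into_def)
  show "inj_on \<psi> V"
    using homeomorphic_imp_injective_map[OF h] openin_subset[OF V] by (simp add: Int_absorb1)
  have "\<psi> ` V \<subseteq> topspace (Euclidean_space (mdim M))"
    using c by (auto simp: chart_into_def dest: openin_subset)
  thus "\<psi> x i = 0" if "x \<in> V" "i \<ge> mdim M" for x i
    using that by (auto simp: topspace_Euclidean_space)
qed

lemma atlas_M_cover:
  assumes "x \<in> points M"
  obtains V \<psi> where "(V, \<psi>) \<in> atlas M" "x \<in> V"
  using assms manifold unfolding analytic_manifold_def analytic_atlas_def by blast

lemma submanifold_immersion: "analytic_immersion S M \<iota>" and mdim_S: "mdim S = 1"
  using submanifold by (simp_all add: analytic_1_submanifold_def)

text \<open>The coordinate of a chart of \<open>S\<close> serves as local parameter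
  \<open>h\<close>. As \<open>\<upsilon>\<close> is only a homeomorphism, \<open>h\<close> is merely
  a continuous injection, while the components of \<open>\<gamma>\<close> are holomorphic functions
  of \<open>h t\<close>. Injectivity of the Jacobian makes one of their derivatives nonzero.\<close>

lemma curve_local:
  assumes t0: "t\<^sub>0 \<in> interior D" and V: "(V, \<psi>) \<in> atlas M" "\<gamma> t\<^sub>0 \<in> V"
  obtains h :: "real \<Rightarrow> real" and C :: "nat \<Rightarrow> complex \<Rightarrow> complex" and d where
    "d > 0" "continuous_on (ball t\<^sub>0 d) h" "inj_on h (ball t\<^sub>0 d)"
    "\<And>j. j < mdim M \<Longrightarrow> C j analytic_on {of_real (h t\<^sub>0)}"
    "\<And>j. j < mdim M \<Longrightarrow> \<forall>\<^sub>F t in nhds t\<^sub>0. C j (of_real (h t)) = of_real (\<psi> (\<gamma> t) j)"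
    "\<exists>l<mdim M. deriv (C l) (of_real (h t\<^sub>0)) \<noteq> 0"
proof -
  have t0D: "t\<^sub>0 \<in> D" using t0 interior_subset by blast
  have atlas_S: "analytic_atlas (half_space 1) S"
    using submanifold unfolding analytic_1_submanifold_def analytic_manifold_with_boundary_def by metis
  have "\<upsilon> t\<^sub>0 \<in> points S" using t0D image_\<upsilon> by blast
  then obtain U \<kappa> where U: "(U, \<kappa>) \<in> atlas S" "\<upsilon> t\<^sub>0 \<in> U"
    using atlas_S unfolding analytic_atlas_def by blast
  have c: "chart_into (half_space 1) (underlying S) (U, \<kappa>)"
    using atlas_S U by (auto simp: analytic_atlas_def)
  hence Uo: "openin (underlying S) U" by (simp add: chart_into_def)
  have hm: "homeomorphic_map (subtopology (underlying S) U) (subtopology (half_space 1) (\<kappa> ` U)) \<kappa>"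
    using c by (simp add: chart_into_def)
  have inj\<kappa>: "inj_on \<kappa> U"
    using homeomorphic_imp_injective_map[OF hm] openin_subset[OF Uo] by (simp add: Int_absorb1)
  \<comment> \<open>The coordinates from index 1 on vanish, so a point of \<open>U\<close> is
    determined by its coordinate \<open>0\<close>.\<close>
  have \<kappa>0: "\<kappa> x i = 0" if "x \<in> U" "i \<ge> 1" for x i
  proof -
    have "\<kappa> ` U \<subseteq> topspace (half_space 1)"
      using c by (auto simp: chart_into_def dest: openin_subset)
    thus ?thesis using topspace_half_space[of "\<kappa> x" 1 i] that by auto
  qed
  define h where "h t = \<kappa> (\<upsilon> t) 0" for t
  have "\<forall>\<^sub>F t in nhds t\<^sub>0. (t \<in> interior D \<and> \<upsilon> t \<in> U) \<and> (t \<in> interior D \<and> \<gamma> t \<in> V)"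
    using chart_M(1)[OF V(1)] V(2) U(2) Uo t0
    by (intro eventually_conj eventually_continuous_map_interior[where X = "underlying S"]
          eventually_continuous_map_interior[where X = "underlying M"] continuous_map_\<upsilon> continuous_map_\<gamma>)
  then obtain d where d: "d > 0" "\<And>t. t \<in> ball t\<^sub>0 d \<Longrightarrow> t \<in> D \<and> \<upsilon> t \<in> U \<and> \<gamma> t \<in> V"
    unfolding eventually_nhds_metric using interior_subset[of D] by (auto simp: dist_commute subset_iff)
  have "continuous_map (top_of_set (ball t\<^sub>0 d)) (subtopology (underlying S) U) \<upsilon>"
    unfolding continuous_map_in_subtopology
    using d(2) by (intro conjI continuous_map_from_subtopology_mono[OF continuous_map_\<upsilon>]) auto
  from continuous_map_compose[OF this homeomorphic_imp_continuous_map[OF hm]]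
  have "continuous_map (top_of_set (ball t\<^sub>0 d)) (half_space 1) (\<kappa> \<circ> \<upsilon>)"
    by (simp add: continuous_map_in_subtopology)
  from continuous_map_compose[OF this continuous_map_half_space_coordinate[of 1 0]]
  have hcont: "continuous_on (ball t\<^sub>0 d) h"
    by (simp add: o_def h_def[abs_def])
  have \<kappa>eq: "\<kappa> x = \<kappa> y" if "x \<in> U" "y \<in> U" "\<kappa> x 0 = \<kappa> y 0" for x y
    using \<kappa>0 that by (metis One_nat_def Suc_leI ext neq0_conv)
  have hinj: "inj_on h (ball t\<^sub>0 d)"
  proof (rule inj_onI)
    fix x y assume xy: "x \<in> ball t\<^sub>0 d" "y \<in> ball t\<^sub>0 d" "h x = h y"
    hence "\<upsilon> x = \<upsilon> y" using d(2) \<kappa>eq inj\<kappa> by (metis h_def inj_onD)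
    thus "x = y" using d(2) xy inj_\<upsilon> by (meson inj_onD)
  qed
  define p A where "p = \<kappa> (\<upsilon> t\<^sub>0)" and "A = \<kappa> ` (U \<inter> \<iota> -` V)"
  define F where "F j x = \<psi> (\<iota> (inv_into U \<kappa> x)) j" for j x
  have chiA: "\<kappa> (\<upsilon> t) \<in> A" "F j (\<kappa> (\<upsilon> t)) = \<psi> (\<gamma> t) j" if "t \<in> ball t\<^sub>0 d" for t j
    using d(2)[OF that] inj\<kappa> by (auto simp: A_def F_def \<gamma>_def)
  have p: "p \<in> A" using chiA d(1) by (simp add: p_def)
  have hn: "(h \<longlongrightarrow> h t\<^sub>0) (nhds t\<^sub>0)"
    using hcont d(1) by (auto simp: continuous_on_eq_continuous_at isCont_def tendsto_at_iff_tendsto_nhds)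
  have near: "\<forall>\<^sub>F t in nhds t\<^sub>0. t \<in> ball t\<^sub>0 d"
    using d(1) by (intro eventually_nhds_in_open) auto
  have "\<exists>E. E analytic_on {of_real (h t\<^sub>0)} \<and>
      (\<forall>\<^sub>F t in nhds t\<^sub>0. E (of_real (h t)) = of_real (\<psi> (\<gamma> t) j))" if j: "j < mdim M" for j
  proof -
    have an: "real_analytic_on 1 (F j) A"
      using submanifold_immersion U(1) V(1) j mdim_S
      unfolding analytic_immersion_def analytic_map_def A_def F_def by fastforce
    obtain E r where E: "r > 0" "E analytic_on {of_real (h t\<^sub>0)}"
      "\<forall>u. \<forall>x\<in>A. (\<forall>i<1. u = of_real (x i) \<and> \<bar>x i - p i\<bar> < r) \<longrightarrow> E u = of_real (F j x)"
      by (rule real_analytic_on_compose_analytic[OF an p, of "\<lambda>_ u. u" "of_real (h t\<^sub>0)"])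
         (auto simp: h_def p_def)
    have "\<forall>\<^sub>F t in nhds t\<^sub>0. dist (h t) (h t\<^sub>0) < r" by (rule tendstoD[OF hn E(1)])
    with near have "\<forall>\<^sub>F t in nhds t\<^sub>0. E (of_real (h t)) = of_real (\<psi> (\<gamma> t) j)"
    proof eventually_elim
      case (elim t)
      have "E (of_real (h t)) = of_real (F j (\<kappa> (\<upsilon> t)))"
        using elim chiA(1)[of t] by (intro E(3)[rule_format]) (auto simp: h_def p_def dist_real_def)
      thus ?case using chiA(2) elim by simp
    qed
    thus ?thesis using E(2) by blast
  qed
  then obtain C where C: "\<And>j. j < mdim M \<Longrightarrow> C j analytic_on {of_real (h t\<^sub>0)}"
      "\<And>j. j < mdim M \<Longrightarrow> \<forall>\<^sub>F t in nhds t\<^sub>0. C j (complex_of_real (h t)) = of_real (\<psi> (\<gamma> t) j)"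
    by metis
  have "\<exists>l<mdim M. deriv (C l) (of_real (h t\<^sub>0)) \<noteq> 0"
  proof -
    obtain J where J: "has_jacobian 1 (mdim M) (\<lambda>x. \<psi> (\<iota> (inv_into U \<kappa> x))) J p A"
      and Jinj: "\<forall>v. (\<forall>j<mdim M. (\<Sum>i<1. J j i * v i) = 0) \<longrightarrow> (\<forall>i<(1::nat). v i = (0::real))"
      using submanifold_immersion[unfolded analytic_immersion_def mdim_S, THEN conjunct2, THEN bspec, OF U(1),
        unfolded prod.case, THEN bspec, OF V(1), unfolded prod.case, THEN bspec, OF p[unfolded A_def]]
      unfolding A_def by blast
    \<comment> \<open>The Jacobian has a single column; tested on the vector \<open>1\<close> it
      must have a nonzero entry.\<close>
    obtain l where l: "l < mdim M" "J l 0 \<noteq> 0"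
      using spec[OF Jinj, of "\<lambda>_. 1"] by auto
    define B where "B = {t. p(0 := t) \<in> A}"
    have der: "((\<lambda>t. F l (p(0 := t))) has_real_derivative J l 0) (at (p 0) within B)"
      using J l unfolding has_jacobian_def F_def B_def by auto
    have upd: "p(0 := h t) = \<kappa> (\<upsilon> t)" if "t \<in> ball t\<^sub>0 d" for t
    proof
      fix i show "(p(0 := h t)) i = \<kappa> (\<upsilon> t) i"
        using \<kappa>0[of "\<upsilon> t" i] \<kappa>0[of "\<upsilon> t\<^sub>0" i] d(2)[OF that] U(2) by (auto simp: h_def p_def)
    qed
    have p0: "p 0 = h t\<^sub>0" by (simp add: p_def h_def)
    have near': "\<forall>\<^sub>F t in at t\<^sub>0. t \<in> ball t\<^sub>0 d \<and> t \<noteq> t\<^sub>0"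
      using near by (auto simp: eventually_at_filter elim: eventually_mono)
    have hneq: "h t \<noteq> h t\<^sub>0" if "t \<in> ball t\<^sub>0 d \<and> t \<noteq> t\<^sub>0" for t
      using that hinj d(1) by (auto dest: inj_onD)
    have ht: "h \<midarrow>t\<^sub>0\<rightarrow> h t\<^sub>0" using hn by (simp add: tendsto_at_iff_tendsto_nhds)
    \<comment> \<open>\<open>h t\<close> approaches \<open>p 0\<close> inside \<open>B\<close>
      without reaching it. So the real derivative within \<open>B\<close> and the complex derivative
      of \<open>C l\<close> are limits of the same difference quotients as \<open>t\<close> tends to
      \<open>t\<^sub>0\<close>.\<close>
    have lim: "filterlim h (at (p 0) within B) (at t\<^sub>0)"
      unfolding filterlim_at
    proof
      show "\<forall>\<^sub>F t in at t\<^sub>0. h t \<in> B \<and> h t \<noteq> p 0"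
        using near' by eventually_elim (use hneq upd chiA p0 in \<open>auto simp: B_def\<close>)
    qed (use ht p0 in simp)
    have "((\<lambda>t. (F l (p(0 := h t)) - F l (p(0 := p 0))) / (h t - p 0)) \<longlongrightarrow> J l 0) (at t\<^sub>0)"
      by (rule filterlim_compose[OF _ lim]) (use der in \<open>simp only: has_field_derivative_iff\<close>)
    hence lim1: "((\<lambda>t. complex_of_real ((F l (p(0 := h t)) - F l (p(0 := p 0))) / (h t - p 0))) \<longlongrightarrow>
        of_real (J l 0)) (at t\<^sub>0)" by (rule tendsto_of_real)
    have limc: "filterlim (\<lambda>t. complex_of_real (h t)) (at (of_real (h t\<^sub>0))) (at t\<^sub>0)"
      unfolding filterlim_at
    proof
      show "\<forall>\<^sub>F t in at t\<^sub>0. complex_of_real (h t) \<in> UNIV \<and> complex_of_real (h t) \<noteq> complex_of_real (h t\<^sub>0)"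
        using near' by eventually_elim (use hneq in auto)
    qed (intro tendsto_of_real ht)
    have "C l field_differentiable at (of_real (h t\<^sub>0))"
      using C(1)[OF l(1)] analytic_on_imp_differentiable_at by blast
    hence "(C l has_field_derivative deriv (C l) (of_real (h t\<^sub>0))) (at (of_real (h t\<^sub>0)))"
      by (simp add: DERIV_deriv_iff_field_differentiable)
    hence lim2: "((\<lambda>t. (C l (of_real (h t)) - C l (of_real (h t\<^sub>0))) / (of_real (h t) - of_real (h t\<^sub>0)))
        \<longlongrightarrow> deriv (C l) (of_real (h t\<^sub>0))) (at t\<^sub>0)"
      by (intro filterlim_compose[OF _ limc]) (simp add: has_field_derivative_iff)
    have C0: "C l (of_real (h t\<^sub>0)) = of_real (F l p)"
      using eventually_nhds_x_imp_x[OF C(2)[OF l(1)]] chiA(2)[of t\<^sub>0 l] d(1) by (simp add: p_def)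
    have "\<forall>\<^sub>F t in at t\<^sub>0. C l (of_real (h t)) = of_real (\<psi> (\<gamma> t) l)"
      using C(2)[OF l(1)] by (auto simp: eventually_at_filter elim: eventually_mono)
    with near' have "\<forall>\<^sub>F t in at t\<^sub>0. complex_of_real ((F l (p(0 := h t)) - F l (p(0 := p 0))) / (h t - p 0))
        = (C l (of_real (h t)) - C l (of_real (h t\<^sub>0))) / (of_real (h t) - of_real (h t\<^sub>0))"
      by eventually_elim (use chiA(2) upd C0 fun_upd_triv[of p 0] in \<open>simp add: p0\<close>)
    from Lim_transform_eventually[OF lim1 this] have "of_real (J l 0) = deriv (C l) (of_real (h t\<^sub>0))"
      by (rule tendsto_unique[OF at_neq_bot _ lim2])
    thus ?thesis using l by auto
  qed
  thus thesis using that[OF d(1) hcont hinj C] by blast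
qed

text \<open>The curve is first extended in a chart around \<open>\<gamma> t\<^sub>0\<close>; the
  resulting holomorphic functions are then substituted into the chart expression of
  \<open>\<phi> g\<close>.\<close>

lemma translated_curve_local:
  assumes g: "g \<in> carrier G" and t0: "t\<^sub>0 \<in> interior D" and V: "(V, \<psi>) \<in> atlas M" "\<phi> g (\<gamma> t\<^sub>0) \<in> V"
  obtains h :: "real \<Rightarrow> real" and E :: "nat \<Rightarrow> complex \<Rightarrow> complex" and d where
    "d > 0" "continuous_on (ball t\<^sub>0 d) h" "inj_on h (ball t\<^sub>0 d)"
    "\<And>j. j < mdim M \<Longrightarrow> E j analytic_on {of_real (h t\<^sub>0)}"
    "\<And>j. j < mdim M \<Longrightarrow> \<forall>\<^sub>F t in nhds t\<^sub>0. E j (of_real (h t)) = of_real (\<psi> (\<phi> g (\<gamma> t)) j)"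
proof -
  have t0D: "t\<^sub>0 \<in> D" using t0 interior_subset by blast
  obtain V' \<psi>' where V': "(V', \<psi>') \<in> atlas M" "\<gamma> t\<^sub>0 \<in> V'"
    using atlas_M_cover \<gamma>_in[OF t0D] by blast
  obtain h C d where h: "d > 0" "continuous_on (ball t\<^sub>0 d) h" "inj_on h (ball t\<^sub>0 d)"
    and C: "\<And>j. j < mdim M \<Longrightarrow> C j analytic_on {complex_of_real (h t\<^sub>0)}"
    "\<And>j. j < mdim M \<Longrightarrow> \<forall>\<^sub>F t in nhds t\<^sub>0. C j (of_real (h t)) = of_real (\<psi>' (\<gamma> t) j)"
    by (rule curve_local[OF t0 V'], rule that)
  define A where "A = \<psi>' ` (V' \<inter> \<phi> g -` V)"
  define F where "F j x = \<psi> (\<phi> g (inv_into V' \<psi>' x)) j" for j x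
  define p where "p = \<psi>' (\<gamma> t\<^sub>0)"
  have p: "p \<in> A" using V' V by (auto simp: A_def p_def)
  have hn: "(h \<longlongrightarrow> h t\<^sub>0) (nhds t\<^sub>0)"
    using h by (auto simp: continuous_on_eq_continuous_at isCont_def tendsto_at_iff_tendsto_nhds)
  have C0: "C i (of_real (h t\<^sub>0)) = of_real (p i)" if "i < mdim M" for i
    using eventually_nhds_x_imp_x[OF C(2)[OF that]] by (simp add: p_def)
  have Call: "\<forall>\<^sub>F t in nhds t\<^sub>0. \<forall>i\<in>{..<mdim M}. C i (of_real (h t)) = of_real (\<psi>' (\<gamma> t) i)"
    using C(2) by (intro eventually_ball_finite) auto
  \<comment> \<open>\<open>E\<close> represents \<open>F j\<close> only at points with coordinates
    within \<open>r\<close> of those of \<open>p\<close>, so the curve has to be kept close to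
    \<open>p\<close>.\<close>
  have Cr: "\<forall>\<^sub>F t in nhds t\<^sub>0. \<forall>i\<in>{..<mdim M}. dist (C i (of_real (h t))) (of_real (p i)) < r"
    if "r > 0" for r
  proof (intro eventually_ball_finite ballI)
    fix i assume i: "i \<in> {..<mdim M}"
    have "((\<lambda>t. C i (of_real (h t))) \<longlongrightarrow> C i (of_real (h t\<^sub>0))) (nhds t\<^sub>0)"
      using C(1) i by (intro isCont_tendsto_compose[where g = "C i"] tendsto_of_real hn)
        (auto intro: analytic_at_imp_isCont)
    from tendstoD[OF this that] show "\<forall>\<^sub>F t in nhds t\<^sub>0. dist (C i (of_real (h t))) (of_real (p i)) < r"
      using C0 i by simp
  qed auto
  have near: "\<forall>\<^sub>F t in nhds t\<^sub>0. (t \<in> interior D \<and> \<gamma> t \<in> V') \<and> (t \<in> interior D \<and> \<phi> g (\<gamma> t) \<in> V)"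
    using chart_M(1)[OF V(1)] chart_M(1)[OF V'(1)] V(2) V'(2) t0 g
    by (intro eventually_conj eventually_continuous_map_interior[where X = "underlying M"]
          continuous_map_\<gamma> continuous_map_\<phi>\<gamma>)
  have "\<exists>E. E analytic_on {of_real (h t\<^sub>0)} \<and>
      (\<forall>\<^sub>F t in nhds t\<^sub>0. E (of_real (h t)) = of_real (\<psi> (\<phi> g (\<gamma> t)) j))" if j: "j < mdim M" for j
  proof -
    have an: "real_analytic_on (mdim M) (F j) A"
      using analytic_action[OF g] V'(1) V(1) j
      unfolding analytic_map_def A_def F_def by fastforce
    obtain r E where E: "r > 0" "E analytic_on {of_real (h t\<^sub>0)}"
      "\<forall>u. \<forall>x\<in>A. (\<forall>i<mdim M. C i u = of_real (x i) \<and> \<bar>x i - p i\<bar> < r) \<longrightarrow> E u = of_real (F j x)"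
      by (rule real_analytic_on_compose_analytic[OF an p C(1) C0])
    have "\<forall>\<^sub>F t in nhds t\<^sub>0. E (of_real (h t)) = of_real (\<psi> (\<phi> g (\<gamma> t)) j)"
      using near Call Cr[OF E(1)]
    proof eventually_elim
      case (elim t)
      have "\<bar>\<psi>' (\<gamma> t) i - p i\<bar> < r" if "i < mdim M" for i
      proof -
        have "dist (complex_of_real (\<psi>' (\<gamma> t) i)) (of_real (p i)) < r"
          using elim that by auto
        thus ?thesis unfolding dist_of_real dist_real_def .
      qed
      hence "E (of_real (h t)) = of_real (F j (\<psi>' (\<gamma> t)))"
        using elim by (intro E(3)[rule_format]) (auto simp: A_def)
      thus ?case using elim chart_M(2)[OF V'(1)] by (simp add: F_def)
    qed
    thus ?thesis using E(2) by blast
  qed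
  then obtain E where "\<And>j. j < mdim M \<Longrightarrow> E j analytic_on {of_real (h t\<^sub>0)}"
      "\<And>j. j < mdim M \<Longrightarrow> \<forall>\<^sub>F t in nhds t\<^sub>0. E j (complex_of_real (h t)) = of_real (\<psi> (\<phi> g (\<gamma> t)) j)"
    by metis
  thus thesis using that[OF h] by blast
qed

end

section \<open>Embeddings, limits and interiors of intervals\<close>

lemma embedding_map_restrict:
  assumes "embedding_map (subtopology X C) Y f" "Q \<subseteq> C"
  shows "embedding_map (subtopology X Q) Y f"
proof -
  have h: "homeomorphic_map (subtopology X C) (subtopology Y (f ` (topspace X \<inter> C))) f"
    using assms(1) by (simp add: embedding_map_def)
  have "homeomorphic_map (subtopology (subtopology X C) Q)
      (subtopology (subtopology Y (f ` (topspace X \<inter> C))) (f ` (topspace X \<inter> Q))) f"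
  proof (rule homeomorphic_map_subtopologies[OF h])
    have "f ` (topspace X \<inter> C) \<subseteq> topspace Y"
      using equalityD1[OF homeomorphic_imp_surjective_map[OF h]] by auto
    thus "f ` (topspace (subtopology X C) \<inter> Q) =
        topspace (subtopology Y (f ` (topspace X \<inter> C))) \<inter> f ` (topspace X \<inter> Q)"
      using assms(2) by auto
  qed
  moreover have "C \<inter> Q = Q" "f ` (topspace X \<inter> C) \<inter> f ` (topspace X \<inter> Q) = f ` (topspace X \<inter> Q)"
    using assms(2) by auto
  ultimately show ?thesis
    by (simp add: embedding_map_def subtopology_subtopology)
qed

lemma limitin_continuous_map_real:
  fixes D :: "real set"
  assumes "continuous_map (top_of_set D) X f" "x \<longlonglongrightarrow> t" "\<And>n. x n \<in> D" "t \<in> D"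
  shows "limitin X (\<lambda>n. f (x n)) (f t) sequentially"
  using continuous_map_limit[OF assms(1), of x t sequentially] assms(2-4)
  by (simp add: limitin_subtopology o_def)

lemma interior_interval_between:
  fixes Y :: "real set"
  assumes "is_interval Y" "x \<in> Y" "y \<in> Y" "x < u" "u < y"
  shows "u \<in> interior Y"
proof (rule interiorI)
  show "{x<..<y} \<subseteq> Y"
  proof
    fix v assume "v \<in> {x<..<y}"
    thus "v \<in> Y" using mem_is_interval_1_I[OF assms(1-3), of v] by simp
  qed
qed (use assms in auto)

section \<open>Accumulating coincidences and their continuation\<close>

context curve_action
begin

text \<open>Both parameters are interior, so that the curves are defined on both sides of them. For
  \<open>g\<close> in \<open>carrier G\<close> the relation is the graph of an injection, since
  \<open>\<gamma>\<close> and its translate are injective.\<close>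

definition matches :: "'g \<Rightarrow> (real \<times> real) set" where
  "matches g = {(t, s). t \<in> interior D \<and> s \<in> interior D \<and> \<phi> g (\<gamma> t) = \<gamma> s}"

text \<open>By analyticity, the accumulation points of the coincidences of \<open>g \<cdot> \<gamma>\<close> with \<open>\<gamma>\<close> are exactly
  the points through which \<open>g \<cdot> \<gamma>\<close> overlaps with \<open>\<gamma>\<close>.\<close>

definition germ :: "'g \<Rightarrow> (real \<times> real) set" where
  "germ g = {p \<in> interior D \<times> interior D. p islimpt matches g}"

lemma germ_interior: "(t, s) \<in> germ g \<Longrightarrow> t \<in> interior D \<and> s \<in> interior D"
  by (simp add: germ_def)

lemma interior_D: "t \<in> interior D \<Longrightarrow> t \<in> D"
  using interior_subset by blast

lemma matches_unique:
  assumes "(t, s) \<in> matches g" "(t, s') \<in> matches g"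
  shows "s = s'"
  using assms interior_D inj_onD[OF inj_\<gamma>, of s s'] by (simp add: matches_def)

lemma matches_inj:
  assumes "g \<in> carrier G" "(t, s) \<in> matches g" "(t', s) \<in> matches g"
  shows "t = t'"
  using assms(2,3) interior_D inj_onD[OF inj_\<phi>\<gamma>[OF assms(1)], of t t'] by (simp add: matches_def)

text \<open>Both curves are continuous and \<open>M\<close> is Hausdorff, so coincidence passes to
  limits.\<close>

lemma germ_matches:
  assumes g: "g \<in> carrier G" and ts: "(t, s) \<in> germ g"
  shows "(t, s) \<in> matches g"
proof -
  have int: "t \<in> interior D" "s \<in> interior D" using germ_interior[OF ts] by auto
  obtain f where f: "\<And>n. f n \<in> matches g" "f \<longlonglongrightarrow> (t, s)"
    using ts unfolding germ_def islimpt_sequential by blast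
  have lims: "(\<lambda>n. fst (f n)) \<longlonglongrightarrow> t" "(\<lambda>n. snd (f n)) \<longlonglongrightarrow> s"
    using tendsto_fst[OF f(2)] tendsto_snd[OF f(2)] by simp_all
  have m: "fst (f n) \<in> D" "snd (f n) \<in> D" "\<phi> g (\<gamma> (fst (f n))) = \<gamma> (snd (f n))" for n
    using f(1)[of n] interior_D by (auto simp: matches_def)
  have l1: "limitin (underlying M) (\<lambda>n. \<phi> g (\<gamma> (fst (f n)))) (\<phi> g (\<gamma> t)) sequentially"
    using limitin_continuous_map_real[OF continuous_map_\<phi>\<gamma>[OF g] lims(1)] m int interior_D by blast
  have l2: "limitin (underlying M) (\<lambda>n. \<gamma> (snd (f n))) (\<gamma> s) sequentially"
    using limitin_continuous_map_real[OF continuous_map_\<gamma> lims(2)] m int interior_D by blast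
  have "\<phi> g (\<gamma> t) = \<gamma> s"
    by (rule limitin_Hausdorff_unique[OF l1[unfolded m(3)] l2 trivial_limit_sequentially Hausdorff])
  thus ?thesis using int by (simp add: matches_def)
qed

text \<open>Accumulation takes place in the first coordinate: a second match over \<open>t\<close>
  itself is excluded because \<open>matches g\<close> is a graph.\<close>

lemma germ_approx:
  assumes g: "g \<in> carrier G" and ts: "(t, s) \<in> germ g" and "\<epsilon> > 0"
  obtains t' s' where "t' \<in> ball t \<epsilon>" "s' \<in> ball s \<epsilon>" "t' \<noteq> t" "(t', s') \<in> matches g"
proof -
  have "(t, s) islimpt matches g" using ts by (simp add: germ_def)
  then obtain p' where p': "p' \<in> matches g" "p' \<noteq> (t, s)" "dist p' (t, s) < \<epsilon>"
    unfolding islimpt_approachable using \<open>\<epsilon> > 0\<close> by blast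
  obtain t' s' where "p' = (t', s')" by (cases p')
  hence p: "(t', s') \<in> matches g" "(t', s') \<noteq> (t, s)" "dist (t', s') (t, s) < \<epsilon>" using p' by auto
  show thesis
  proof (rule that[OF _ _ _ p(1)])
    show "t' \<in> ball t \<epsilon>" using p(3) dist_fst_le[of "(t', s')" "(t, s)"] by (simp add: dist_commute)
    show "s' \<in> ball s \<epsilon>" using p(3) dist_snd_le[of "(t', s')" "(t, s)"] by (simp add: dist_commute)
    show "t' \<noteq> t" using p germ_matches[OF g ts] matches_unique by blast
  qed
qed

lemma germI:
  assumes "t \<in> interior D" "s \<in> interior D"
    and "\<And>\<epsilon>. \<epsilon> > 0 \<Longrightarrow> \<exists>t'\<in>ball t \<epsilon>. \<exists>s'\<in>ball s \<epsilon>. (t', s') \<noteq> (t, s) \<and> (t', s') \<in> matches g"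
  shows "(t, s) \<in> germ g"
proof -
  have "(t, s) islimpt matches g"
    unfolding islimpt_approachable
  proof (intro allI impI)
    fix \<epsilon> :: real assume "\<epsilon> > 0"
    then obtain t' s' where p: "t' \<in> ball t (\<epsilon> / 2)" "s' \<in> ball s (\<epsilon> / 2)" "(t', s') \<noteq> (t, s)"
        "(t', s') \<in> matches g"
      using assms(3)[of "\<epsilon> / 2"] by auto
    have "dist (t', s') (t, s) \<le> dist t' t + dist s' s"
      unfolding dist_Pair_Pair by (rule sqrt_sum_squares_le_sum) auto
    thus "\<exists>x'\<in>matches g. x' \<noteq> (t, s) \<and> dist x' (t, s) < \<epsilon>"
      using p by (intro bexI[of _ "(t', s')"]) (auto simp: dist_commute)
  qed
  thus ?thesis using assms by (simp add: germ_def)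
qed

text \<open>Only the first parameters are known to converge. Compactness of \<open>K\<close> yields
  a limit of a subsequence of the second ones; uniqueness of limits and injectivity of
  \<open>\<gamma>\<close> identify it with \<open>s\<close>.\<close>

lemma germI_sequentially:
  assumes g: "g \<in> carrier G" and int: "t \<in> interior D" "s \<in> interior D" and eq: "\<phi> g (\<gamma> t) = \<gamma> s"
    and K: "compact K" "K \<subseteq> D"
    and x: "x \<longlonglongrightarrow> t" "\<And>n. x n \<noteq> t" "\<And>n. x n \<in> D" and y: "\<And>n. y n \<in> K"
    and xy: "\<And>n. \<phi> g (\<gamma> (x n)) = \<gamma> (y n)"
  shows "(t, s) \<in> germ g"
proof -
  obtain s' r where r: "s' \<in> K" "strict_mono r" "(y \<circ> r) \<longlonglongrightarrow> s'"
    using K(1) y unfolding compact_def by blast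
  have xr: "(\<lambda>n. x (r n)) \<longlonglongrightarrow> t"
    using LIMSEQ_subseq_LIMSEQ[OF x(1) r(2)] by (simp add: o_def)
  have l1: "limitin (underlying M) (\<lambda>n. \<phi> g (\<gamma> (x (r n)))) (\<phi> g (\<gamma> t)) sequentially"
    using limitin_continuous_map_real[OF continuous_map_\<phi>\<gamma>[OF g] xr] x(3) int interior_D by blast
  have l2: "limitin (underlying M) (\<lambda>n. \<gamma> (y (r n))) (\<gamma> s') sequentially"
    using limitin_continuous_map_real[OF continuous_map_\<gamma>, of "\<lambda>n. y (r n)" s'] r y K
    by (auto simp: o_def)
  have "\<phi> g (\<gamma> t) = \<gamma> s'"
    by (rule limitin_Hausdorff_unique[OF l1[unfolded xy] l2 trivial_limit_sequentially Hausdorff])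
  hence "s' = s" using eq inj_\<gamma> r(1) K int interior_D by (metis inj_onD subsetD)
  hence yr: "(\<lambda>n. y (r n)) \<longlonglongrightarrow> s" using r by (simp add: o_def)
  show ?thesis
  proof (rule germI[OF int])
    fix \<epsilon> :: real assume "\<epsilon> > 0"
    have "\<forall>\<^sub>F n in sequentially. x (r n) \<in> interior D \<inter> ball t \<epsilon>"
      using int \<open>\<epsilon> > 0\<close> by (intro topological_tendstoD[OF xr]) auto
    moreover have "\<forall>\<^sub>F n in sequentially. y (r n) \<in> interior D \<inter> ball s \<epsilon>"
      using int \<open>\<epsilon> > 0\<close> by (intro topological_tendstoD[OF yr]) auto
    ultimately have "\<forall>\<^sub>F n in sequentially. x (r n) \<in> interior D \<inter> ball t \<epsilon> \<and> y (r n) \<in> interior D \<inter> ball s \<epsilon>"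
      by eventually_elim blast
    then obtain n where "x (r n) \<in> interior D \<inter> ball t \<epsilon>" "y (r n) \<in> interior D \<inter> ball s \<epsilon>"
      using eventually_happens' sequentially_bot by blast
    thus "\<exists>t'\<in>ball t \<epsilon>. \<exists>s'\<in>ball s \<epsilon>. (t', s') \<noteq> (t, s) \<and> (t', s') \<in> matches g"
      using x(2) xy by (intro bexI[of _ "x (r n)"] bexI[of _ "y (r n)"]) (auto simp: matches_def)
  qed
qed

text \<open>Here analyticity enters: in charts, the accumulating coincidences meet the hypotheses of
  \<open>analytic_curves_coincide\<close>, so matches exist over a full neighbourhood of
  \<open>t\<^sub>0\<close>.\<close>

lemma germ_extend_matches:
  assumes g: "g \<in> carrier G" and ts: "(t\<^sub>0, s\<^sub>0) \<in> germ g" and "\<delta> > 0"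
  shows "\<forall>\<^sub>F t in nhds t\<^sub>0. \<exists>s\<in>ball s\<^sub>0 \<delta>. (t, s) \<in> matches g"
proof -
  have int: "t\<^sub>0 \<in> interior D" "s\<^sub>0 \<in> interior D" using germ_interior[OF ts] by auto
  have eq: "\<phi> g (\<gamma> t\<^sub>0) = \<gamma> s\<^sub>0" using germ_matches[OF g ts] by (simp add: matches_def)
  obtain V \<psi> where V: "(V, \<psi>) \<in> atlas M" "\<gamma> s\<^sub>0 \<in> V"
    using atlas_M_cover \<gamma>_in[OF interior_D[OF int(2)]] by blast
  have V': "\<phi> g (\<gamma> t\<^sub>0) \<in> V" using V eq by simp
  obtain k :: "real \<Rightarrow> real" and C d1 where k: "d1 > 0" "continuous_on (ball s\<^sub>0 d1) k" "inj_on k (ball s\<^sub>0 d1)"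
    and C: "\<And>j. j < mdim M \<Longrightarrow> C j analytic_on {complex_of_real (k s\<^sub>0)}"
      "\<And>j. j < mdim M \<Longrightarrow> \<forall>\<^sub>F s in nhds s\<^sub>0. C j (of_real (k s)) = of_real (\<psi> (\<gamma> s) j)"
    and imm: "\<exists>l<mdim M. deriv (C l) (of_real (k s\<^sub>0)) \<noteq> 0"
    by (rule curve_local[OF int(2) V], rule that)
  obtain h :: "real \<Rightarrow> real" and E d2 where h: "d2 > 0" "continuous_on (ball t\<^sub>0 d2) h" "inj_on h (ball t\<^sub>0 d2)"
    and E: "\<And>j. j < mdim M \<Longrightarrow> E j analytic_on {complex_of_real (h t\<^sub>0)}"
      "\<And>j. j < mdim M \<Longrightarrow> \<forall>\<^sub>F t in nhds t\<^sub>0. E j (of_real (h t)) = of_real (\<psi> (\<phi> g (\<gamma> t)) j)"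
    by (rule translated_curve_local[OF g int(1) V(1) V'], rule that)
  obtain l where l: "l < mdim M" "deriv (C l) (of_real (k s\<^sub>0)) \<noteq> 0" using imm by blast
  have "\<forall>\<^sub>F t in nhds t\<^sub>0. (\<forall>j\<in>{..<mdim M}. E j (of_real (h t)) = of_real (\<psi> (\<phi> g (\<gamma> t)) j)) \<and>
      t \<in> interior D \<and> \<phi> g (\<gamma> t) \<in> V"
    using E(2) V' int chart_M(1)[OF V(1)] g
    by (intro eventually_conj[OF eventually_ball_finite]
          eventually_continuous_map_interior[where X = "underlying M"] continuous_map_\<phi>\<gamma>) auto
  then obtain d3 where d3: "d3 > 0"
    "\<And>t. t \<in> ball t\<^sub>0 d3 \<Longrightarrow> (\<forall>j\<in>{..<mdim M}. E j (of_real (h t)) = of_real (\<psi> (\<phi> g (\<gamma> t)) j)) \<and>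
      t \<in> interior D \<and> \<phi> g (\<gamma> t) \<in> V"
    unfolding eventually_nhds_metric by (metis dist_commute mem_ball)
  have "\<forall>\<^sub>F s in nhds s\<^sub>0. (\<forall>j\<in>{..<mdim M}. C j (of_real (k s)) = of_real (\<psi> (\<gamma> s) j)) \<and>
      s \<in> interior D \<and> \<gamma> s \<in> V"
    using C(2) V int chart_M(1)[OF V(1)]
    by (intro eventually_conj[OF eventually_ball_finite]
          eventually_continuous_map_interior[where X = "underlying M"] continuous_map_\<gamma>) auto
  then obtain d4 where d4: "d4 > 0"
    "\<And>s. s \<in> ball s\<^sub>0 d4 \<Longrightarrow> (\<forall>j\<in>{..<mdim M}. C j (of_real (k s)) = of_real (\<psi> (\<gamma> s) j)) \<and>
      s \<in> interior D \<and> \<gamma> s \<in> V"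
    unfolding eventually_nhds_metric by (metis dist_commute mem_ball)
  define d where "d = Min {d1, d2, d3, d4}"
  have d: "d > 0" "ball t\<^sub>0 d \<subseteq> ball t\<^sub>0 d2" "ball t\<^sub>0 d \<subseteq> ball t\<^sub>0 d3" "ball s\<^sub>0 d \<subseteq> ball s\<^sub>0 d1" "ball s\<^sub>0 d \<subseteq> ball s\<^sub>0 d4"
    using h(1) k(1) d3(1) d4(1) by (auto simp: d_def)
  \<comment> \<open>Coincidence in \<open>M\<close> is equality of the first \<open>mdim M\<close>
    chart coordinates, as the remaining ones vanish and \<open>\<psi>\<close> is injective on
    \<open>V\<close>.\<close>
  have matches_iff: "(t, s) \<in> matches g \<longleftrightarrow> (\<forall>j<mdim M. \<psi> (\<phi> g (\<gamma> t)) j = \<psi> (\<gamma> s) j)"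
    if "t \<in> ball t\<^sub>0 d" "s \<in> ball s\<^sub>0 d" for t s
  proof -
    have ts: "t \<in> interior D" "\<phi> g (\<gamma> t) \<in> V" "s \<in> interior D" "\<gamma> s \<in> V"
      using d3(2) d4(2) d that by blast+
    have "\<phi> g (\<gamma> t) = \<gamma> s" if "\<forall>j<mdim M. \<psi> (\<phi> g (\<gamma> t)) j = \<psi> (\<gamma> s) j"
    proof -
      have "\<psi> (\<phi> g (\<gamma> t)) = \<psi> (\<gamma> s)"
        using that chart_M(3)[OF V(1)] ts by (metis ext not_le)
      thus ?thesis using chart_M(2)[OF V(1)] ts by (auto dest: inj_onD)
    qed
    thus ?thesis using ts by (auto simp: matches_def)
  qed
  have "\<forall>\<^sub>F t in nhds t\<^sub>0. \<exists>s\<in>ball s\<^sub>0 (min \<delta> d). \<forall>j<mdim M. \<psi> (\<phi> g (\<gamma> t)) j = \<psi> (\<gamma> s) j"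
  proof (rule analytic_curves_coincide[where d = d and h = h and k = k and E = E and C = C and l = l])
    show "continuous_on (ball t\<^sub>0 d) h" "inj_on h (ball t\<^sub>0 d)"
      using h d by (blast intro: continuous_on_subset inj_on_subset)+
    show "continuous_on (ball s\<^sub>0 d) k" "inj_on k (ball s\<^sub>0 d)"
      using k d by (blast intro: continuous_on_subset inj_on_subset)+
    show "\<exists>t\<in>ball t\<^sub>0 \<epsilon>. \<exists>s\<in>ball s\<^sub>0 \<epsilon>. t \<noteq> t\<^sub>0 \<and> (\<forall>j<mdim M. \<psi> (\<phi> g (\<gamma> t)) j = \<psi> (\<gamma> s) j)"
      if "\<epsilon> > 0" for \<epsilon>
    proof -
      have pos: "min \<epsilon> d > 0" using that d by simp
      obtain t s where "t \<in> ball t\<^sub>0 (min \<epsilon> d)" "s \<in> ball s\<^sub>0 (min \<epsilon> d)" "t \<noteq> t\<^sub>0" "(t, s) \<in> matches g"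
        by (rule germ_approx[OF g ts pos])
      thus ?thesis using matches_iff[of t s] by (intro bexI[of _ t] bexI[of _ s]) auto
    qed
  qed (use E(1) C(1) l d3(2) d4(2) d eq \<open>\<delta> > 0\<close> in auto)
  moreover have "\<forall>\<^sub>F t in nhds t\<^sub>0. t \<in> ball t\<^sub>0 d" using d(1) by (intro eventually_nhds_in_open) auto
  ultimately show ?thesis
  proof eventually_elim
    case (elim t)
    then obtain s where "s \<in> ball s\<^sub>0 (min \<delta> d)" "\<forall>j<mdim M. \<psi> (\<phi> g (\<gamma> t)) j = \<psi> (\<gamma> s) j" by blast
    thus ?case using matches_iff[of t s] elim by (intro bexI[of _ s]) auto
  qed
qed

text \<open>If all parameters near \<open>t\<close> have matches in a fixed compact ball, then the
  match over \<open>t\<close> is itself an accumulation point. So extending matches extends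
  germs.\<close>

lemma germ_extend:
  assumes g: "g \<in> carrier G" and ts: "(t\<^sub>0, s\<^sub>0) \<in> germ g" and "\<delta> > 0"
  shows "\<forall>\<^sub>F t in nhds t\<^sub>0. \<exists>s\<in>ball s\<^sub>0 \<delta>. (t, s) \<in> germ g"
proof -
  have int: "t\<^sub>0 \<in> interior D" "s\<^sub>0 \<in> interior D" using germ_interior[OF ts] by auto
  obtain e where e: "e > 0" "cball s\<^sub>0 e \<subseteq> interior D"
    using int(2) open_contains_cball open_interior by blast
  \<comment> \<open>The closed ball of this radius is the compact set that
    \<open>germI_sequentially\<close> asks for.\<close>
  define \<eta> where "\<eta> = min \<delta> e"
  have \<eta>: "\<eta> > 0" "\<eta> \<le> \<delta>" "cball s\<^sub>0 \<eta> \<subseteq> interior D"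
    using e \<open>\<delta> > 0\<close> by (auto simp: \<eta>_def)
  have "\<forall>\<^sub>F t in nhds t\<^sub>0. \<exists>s\<in>ball s\<^sub>0 \<eta>. (t, s) \<in> matches g"
    by (rule germ_extend_matches[OF g ts \<eta>(1)])
  hence "\<forall>\<^sub>F t in nhds t\<^sub>0. \<forall>\<^sub>F t' in nhds t. \<exists>s\<in>ball s\<^sub>0 \<eta>. (t', s) \<in> matches g"
    by (simp only: eventually_eventually)
  thus ?thesis
  proof eventually_elim
    case (elim t)
    then obtain s where s: "s \<in> ball s\<^sub>0 \<eta>" "(t, s) \<in> matches g"
      using eventually_nhds_x_imp_x by blast
    obtain d where d: "d > 0" "\<And>t'. t' \<in> ball t d \<Longrightarrow> \<exists>s\<in>ball s\<^sub>0 \<eta>. (t', s) \<in> matches g"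
      using elim unfolding eventually_nhds_metric by (metis dist_commute mem_ball)
    have "t islimpt ball t d" using d(1) by (intro interior_limit_point) auto
    then obtain x where x: "\<And>n. x n \<in> ball t d - {t}" "x \<longlonglongrightarrow> t"
      unfolding islimpt_sequential by blast
    have "\<forall>n. \<exists>s\<in>ball s\<^sub>0 \<eta>. (x n, s) \<in> matches g" using d(2) x(1) by blast
    then obtain y where y: "\<And>n. y n \<in> ball s\<^sub>0 \<eta>" "\<And>n. (x n, y n) \<in> matches g" by metis
    have "(t, s) \<in> germ g"
    proof (rule germI_sequentially[OF g _ _ _ compact_cball _ x(2)])
      show "t \<in> interior D" "s \<in> interior D" "\<phi> g (\<gamma> t) = \<gamma> s" using s by (auto simp: matches_def)
      show "cball s\<^sub>0 \<eta> \<subseteq> D" using \<eta>(3) interior_subset by blast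
      show "x n \<noteq> t" for n using x(1) by blast
      show "x n \<in> D" "\<phi> g (\<gamma> (x n)) = \<gamma> (y n)" for n
        using y(2)[of n] interior_D by (auto simp: matches_def)
      show "y n \<in> cball s\<^sub>0 \<eta>" for n using y(1)[of n] by simp
    qed
    thus ?case using s \<eta>(2) by (intro bexI[of _ s]) auto
  qed
qed

section \<open>Composition of germs and the stabilizer of the curve\<close>

lemma group_G: "group G"
  using action group_action.group_hom group_hom.axioms(1) by blast

lemma action_mult:
  "g \<in> carrier G \<Longrightarrow> g' \<in> carrier G \<Longrightarrow> x \<in> points M \<Longrightarrow> \<phi> (g' \<otimes>\<^bsub>G\<^esub> g) x = \<phi> g' (\<phi> g x)"
  using group_action.composition_rule[OF action] by blast

lemma action_inv:
  "g \<in> carrier G \<Longrightarrow> x \<in> points M \<Longrightarrow> \<phi> g x = y \<Longrightarrow> \<phi> (inv\<^bsub>G\<^esub> g) y = x"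
  using group_action.orbit_sym_aux[OF action] by blast

text \<open>Every parameter near \<open>s\<close> has a match for \<open>g'\<close> near
  \<open>u\<close>. Applied to the second entries of matches of \<open>g\<close> approaching
  \<open>(t, s)\<close>, this yields matches of the product approaching \<open>(t, u)\<close>; they
  differ from it in the first coordinate.\<close>

lemma germ_mult:
  assumes g: "g \<in> carrier G" "g' \<in> carrier G" and ts: "(t, s) \<in> germ g" and su: "(s, u) \<in> germ g'"
  shows "(t, u) \<in> germ (g' \<otimes>\<^bsub>G\<^esub> g)"
proof (rule germI)
  show "t \<in> interior D" "u \<in> interior D" using germ_interior ts su by blast+
  fix \<epsilon> :: real assume \<epsilon>: "\<epsilon> > 0"
  obtain \<delta> where \<delta>: "\<delta> > 0" "\<And>s'. s' \<in> ball s \<delta> \<Longrightarrow> \<exists>u'\<in>ball u \<epsilon>. (s', u') \<in> matches g'"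
    using germ_extend_matches[OF g(2) su \<epsilon>] unfolding eventually_nhds_metric
    by (metis dist_commute mem_ball)
  have pos: "min \<epsilon> \<delta> > 0" using \<epsilon> \<delta> by simp
  obtain t' s' where t': "t' \<in> ball t (min \<epsilon> \<delta>)" "s' \<in> ball s (min \<epsilon> \<delta>)" "t' \<noteq> t" "(t', s') \<in> matches g"
    by (rule germ_approx[OF g(1) ts pos])
  obtain u' where u': "u' \<in> ball u \<epsilon>" "(s', u') \<in> matches g'"
    using \<delta>(2)[of s'] t'(2) by auto
  have "t' \<in> D" using t'(4) interior_D by (auto simp: matches_def)
  hence "(t', u') \<in> matches (g' \<otimes>\<^bsub>G\<^esub> g)"
    using t'(4) u'(2) action_mult[OF g \<gamma>_in] by (auto simp: matches_def)
  thus "\<exists>t'\<in>ball t \<epsilon>. \<exists>u'\<in>ball u \<epsilon>. (t', u') \<noteq> (t, u) \<and> (t', u') \<in> matches (g' \<otimes>\<^bsub>G\<^esub> g)"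
    using t' u' by (intro bexI[of _ t'] bexI[of _ u']) auto
qed

lemma germ_inv:
  assumes g: "g \<in> carrier G" and ts: "(t, s) \<in> germ g"
  shows "(s, t) \<in> germ (inv\<^bsub>G\<^esub> g)"
proof (rule germI)
  show "s \<in> interior D" "t \<in> interior D" using germ_interior[OF ts] by blast+
  fix \<epsilon> :: real assume \<epsilon>: "\<epsilon> > 0"
  obtain t' s' where t': "t' \<in> ball t \<epsilon>" "s' \<in> ball s \<epsilon>" "t' \<noteq> t" "(t', s') \<in> matches g"
    by (rule germ_approx[OF g ts \<epsilon>])
  have "t' \<in> D" using t'(4) interior_D by (auto simp: matches_def)
  hence "(s', t') \<in> matches (inv\<^bsub>G\<^esub> g)"
    using t'(4) action_inv[OF g \<gamma>_in] by (auto simp: matches_def)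
  thus "\<exists>s'\<in>ball s \<epsilon>. \<exists>t'\<in>ball t \<epsilon>. (s', t') \<noteq> (s, t) \<and> (s', t') \<in> matches (inv\<^bsub>G\<^esub> g)"
    using t' by (intro bexI[of _ s'] bexI[of _ t']) auto
qed

abbreviation Stab :: "'g set" where
  "Stab \<equiv> stab_submfd G \<phi> S \<iota>"

lemma Stab_iff: "g \<in> Stab \<longleftrightarrow> g \<in> carrier G \<and> (\<forall>t\<in>D. \<phi> g (\<gamma> t) = \<gamma> t)"
proof -
  \<comment> \<open>Membership in \<open>carrier G\<close> comes from the stabilizer of at least one
    point of the curve.\<close>
  have "D \<noteq> {}" using parametrization by (auto simp: interval_parametrization_def)
  thus ?thesis
    unfolding stab_submfd_def stabilizer_def \<gamma>_def image_\<upsilon>[symmetric] by auto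
qed

lemma germ_Stab:
  assumes h: "h \<in> Stab" and t: "t \<in> interior D"
  shows "(t, t) \<in> germ h"
proof (rule germI[OF t t])
  fix \<epsilon> :: real assume "\<epsilon> > 0"
  hence "t islimpt (interior D \<inter> ball t \<epsilon>)"
    using t by (intro interior_limit_point) auto
  then obtain t' where "t' \<in> interior D \<inter> ball t \<epsilon>" "t' \<noteq> t"
    unfolding islimpt_approachable using \<open>\<epsilon> > 0\<close> by blast
  thus "\<exists>t'\<in>ball t \<epsilon>. \<exists>s'\<in>ball t \<epsilon>. (t', s') \<noteq> (t, t) \<and> (t', s') \<in> matches h"
    using h interior_D by (intro bexI[of _ t']) (auto simp: matches_def Stab_iff)
qed

lemma subgroup_Stab: "subgroup Stab G"
proof -
  interpret group G by (rule group_G)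
  show ?thesis
  proof (rule subgroupI)
    show "Stab \<subseteq> carrier G" by (auto simp: Stab_iff)
    have "\<phi> \<one>\<^bsub>G\<^esub> (\<gamma> t) = \<gamma> t" if "t \<in> D" for t
      using group_action.id_eq_one[OF action] \<gamma>_in[OF that] by (metis restrict_apply')
    hence "\<one>\<^bsub>G\<^esub> \<in> Stab" by (simp add: Stab_iff)
    thus "Stab \<noteq> {}" by blast
  next
    fix a assume "a \<in> Stab"
    thus "inv\<^bsub>G\<^esub> a \<in> Stab" using action_inv \<gamma>_in by (auto simp: Stab_iff)
  next
    fix a b assume "a \<in> Stab" "b \<in> Stab"
    thus "a \<otimes>\<^bsub>G\<^esub> b \<in> Stab" using action_mult \<gamma>_in by (auto simp: Stab_iff)
  qed
qed

lemma coset_class_eqI: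
  assumes g: "g \<in> carrier G" "g' \<in> carrier G" and "inv\<^bsub>G\<^esub> g \<otimes>\<^bsub>G\<^esub> g' \<in> Stab"
  shows "coset_class G \<phi> S \<iota> g' = coset_class G \<phi> S \<iota> g"
proof -
  interpret group G by (rule group_G)
  have "g' = g \<otimes>\<^bsub>G\<^esub> (inv\<^bsub>G\<^esub> g \<otimes>\<^bsub>G\<^esub> g')"
    using g by (simp add: m_assoc[symmetric])
  hence "g' \<in> g <#\<^bsub>G\<^esub> Stab" using assms(3) by (auto simp: l_coset_def)
  thus ?thesis
    using l_repr_independence[OF _ g(1) subgroup_Stab] by (auto simp: coset_class_def)
qed

lemma coset_class_one_iff:
  assumes "g \<in> carrier G"
  shows "coset_class G \<phi> S \<iota> g = coset_class G \<phi> S \<iota> \<one>\<^bsub>G\<^esub> \<longleftrightarrow> g \<in> Stab"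
proof -
  interpret group G by (rule group_G)
  have sub: "Stab \<subseteq> carrier G" by (auto simp: Stab_iff)
  have 1: "coset_class G \<phi> S \<iota> \<one>\<^bsub>G\<^esub> = Stab"
    using lcos_mult_one[OF sub] by (simp add: coset_class_def)
  have "g \<in> coset_class G \<phi> S \<iota> g"
    using assms subgroup.one_closed[OF subgroup_Stab] by (force simp: coset_class_def l_coset_def)
  moreover have "coset_class G \<phi> S \<iota> g = coset_class G \<phi> S \<iota> \<one>\<^bsub>G\<^esub>" if "g \<in> Stab"
    using assms that by (intro coset_class_eqI) auto
  ultimately show ?thesis using 1 by auto
qed

section \<open>Segments as real intervals, overlaps as germs\<close>

text \<open>This is the set whose interior defines \<open>seg_interior\<close>; it turns segments
  into nondegenerate real intervals.\<close>

definition pre :: "'s set \<Rightarrow> real set" where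
  "pre \<Sigma> = {t \<in> D. \<upsilon> t \<in> \<Sigma>}"

lemma pre_subset: "pre \<Sigma> \<subseteq> D"
  by (auto simp: pre_def)

lemma interior_pre: "t \<in> interior (pre \<Sigma>) \<Longrightarrow> t \<in> interior D"
  using interior_mono[OF pre_subset] by blast

lemma image_pre: "\<Sigma> \<subseteq> points S \<Longrightarrow> \<upsilon> ` pre \<Sigma> = \<Sigma>"
  using image_\<upsilon> by (auto simp: pre_def)

lemma segment_pre:
  assumes "\<Sigma> \<in> segments S"
  shows "\<Sigma> \<subseteq> points S" "is_interval (pre \<Sigma>)" "\<exists>a\<in>pre \<Sigma>. \<exists>b\<in>pre \<Sigma>. a < b"
proof -
  have con: "connectedin (underlying S) \<Sigma>" using assms by (simp add: segments_def)
  show sub: "\<Sigma> \<subseteq> points S" using connectedin_subset_topspace[OF con] .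
  have "connectedin (top_of_set D) (pre \<Sigma>)"
    using con image_pre[OF sub] pre_subset homeomorphic_map_connectedness_eq[OF homeo] by simp
  thus "is_interval (pre \<Sigma>)"
    by (simp add: connectedin_subtopology is_interval_connected_1)
  obtain x y where xy: "x \<in> \<Sigma>" "y \<in> \<Sigma>" "x \<noteq> y" using assms by (auto simp: segments_def)
  have "x \<in> \<upsilon> ` pre \<Sigma>" "y \<in> \<upsilon> ` pre \<Sigma>" using xy by (simp_all add: image_pre[OF sub])
  then obtain a b where a: "a \<in> pre \<Sigma>" "\<upsilon> a = x" and b: "b \<in> pre \<Sigma>" "\<upsilon> b = y" by blast
  have "a \<noteq> b" using a b xy by auto
  thus "\<exists>a\<in>pre \<Sigma>. \<exists>b\<in>pre \<Sigma>. a < b" using a b by (meson linorder_neqE)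
qed

lemma open_segmentI:
  assumes "open I" "connected I" "I \<subseteq> D" "a \<in> I" "b \<in> I" "a \<noteq> b"
  shows "\<upsilon> ` I \<in> segments S" "openin (underlying S) (\<upsilon> ` I)"
proof -
  have "connectedin (underlying S) (\<upsilon> ` I)"
    using assms by (intro connectedin_continuous_map_image[OF continuous_map_\<upsilon>])
      (simp add: connectedin_subtopology)
  moreover have "\<upsilon> a \<noteq> \<upsilon> b" using inj_\<upsilon> assms by (auto dest: inj_onD)
  ultimately show "\<upsilon> ` I \<in> segments S" using assms by (auto simp: segments_def)
  have "openin (top_of_set D) I" using assms by (intro open_subset)
  thus "openin (underlying S) (\<upsilon> ` I)"
    using homeomorphic_map_openness_eq[OF homeo] by blast
qed

text \<open>A continuous injection from a compact space into a Hausdorff space is an embedding, and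
  embeddings restrict to subsets. This supplies the embedding conditions in
  \<open>overlaps\<close>.\<close>

lemma embedding_map_compact:
  assumes "compact C" "C \<subseteq> D" "Q \<subseteq> \<upsilon> ` C"
  shows "embedding_map (subtopology (underlying S) Q) (underlying M) \<iota>"
proof (rule embedding_map_restrict[OF continuous_imp_embedding_map assms(3)])
  show "continuous_map (subtopology (underlying S) (\<upsilon> ` C)) (underlying M) \<iota>"
    by (intro continuous_map_from_subtopology continuous_map_\<iota>)
  have "compactin (underlying S) (\<upsilon> ` C)"
    using assms by (intro image_compactin[OF _ continuous_map_\<upsilon>]) (simp add: compactin_subtopology)
  thus "compact_space (subtopology (underlying S) (\<upsilon> ` C))" by (rule compact_space_subtopology)
  show "Hausdorff_space (underlying M)" by (rule Hausdorff)
  show "inj_on \<iota> (topspace (subtopology (underlying S) (\<upsilon> ` C)))"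
    using inj_\<iota> by (rule inj_on_subset) auto
qed

text \<open>Each interior parameter of \<open>Q\<close> matches a parameter of \<open>Q'\<close>,
  but that one might be an end point, and nearby parameters might match distant ones. The first is
  avoided by a choice among three parameters, the second by the embedding condition on
  \<open>Q'\<close>.\<close>

lemma overlaps_germ:
  assumes g: "g \<in> carrier G" and ov: "overlaps \<phi> M S \<iota> g \<Sigma> \<Sigma>'"
  obtains t s where "(t, s) \<in> germ g" "t \<in> interior (pre \<Sigma>)" "s \<in> interior (pre \<Sigma>')"
proof -
  obtain Q Q' where Q: "Q \<in> segments S" "Q \<subseteq> \<Sigma>" and Q': "Q' \<in> segments S" "Q' \<subseteq> \<Sigma>'"
    and emb: "embedding_map (subtopology (underlying S) Q') (underlying M) \<iota>"
    and eq: "\<phi> g ` \<iota> ` Q = \<iota> ` Q'"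
    using ov unfolding overlaps_def by blast
  obtain a b where ab: "a \<in> pre Q" "b \<in> pre Q" "a < b" using segment_pre(3)[OF Q(1)] by blast
  have abQ: "t \<in> interior (pre Q)" if "t \<in> {a<..<b}" for t
    using interior_interval_between[OF segment_pre(2)[OF Q(1)] ab(1,2)] that by simp
  have ex: "\<exists>s\<in>pre Q'. \<phi> g (\<gamma> t) = \<gamma> s" if "t \<in> {a<..<b}" for t
  proof -
    have "\<upsilon> t \<in> Q" using abQ[OF that] interior_subset by (auto simp: pre_def)
    hence "\<phi> g (\<gamma> t) \<in> \<iota> ` \<upsilon> ` pre Q'"
      using eq image_pre[OF segment_pre(1)[OF Q'(1)]] by (auto simp: \<gamma>_def)
    thus ?thesis by (auto simp: \<gamma>_def)
  qed
  then obtain \<tau> where \<tau>: "\<And>t. t \<in> {a<..<b} \<Longrightarrow> \<tau> t \<in> pre Q' \<and> \<phi> g (\<gamma> t) = \<gamma> (\<tau> t)"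
    by metis
  have abD: "t \<in> D" if "t \<in> {a<..<b}" for t using abQ[OF that] interior_pre interior_D by blast
  have \<tau>inj: "\<tau> x \<noteq> \<tau> y" if "x \<in> {a<..<b}" "y \<in> {a<..<b}" "x \<noteq> y" for x y
    using \<tau>[OF that(1)] \<tau>[OF that(2)] inj_onD[OF inj_\<phi>\<gamma>[OF g], of x y] abD that by auto
  have mid: "\<exists>t\<in>{a<..<b}. \<tau> t \<in> interior (pre Q')"
    if "u \<in> {a<..<b}" "v \<in> {a<..<b}" "w \<in> {a<..<b}" "\<tau> u < \<tau> v" "\<tau> v < \<tau> w" for u v w
    using interior_interval_between[OF segment_pre(2)[OF Q'(1)], of "\<tau> u" "\<tau> w" "\<tau> v"] \<tau> that by blast
  have "\<exists>t\<in>{a<..<b}. \<tau> t \<in> interior (pre Q')"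
  proof -
    \<comment> \<open>Three distinct parameters have three distinct matches, and the middle one of
      these is interior.\<close>
    define x y z where "x = a + (b - a) / 4" and "y = a + (b - a) / 2" and "z = a + 3 * (b - a) / 4"
    have xyz: "x \<in> {a<..<b}" "y \<in> {a<..<b}" "z \<in> {a<..<b}" "x \<noteq> y" "y \<noteq> z" "x \<noteq> z"
      using ab(3) by (auto simp: x_def y_def z_def field_simps)
    have "\<tau> x \<noteq> \<tau> y" "\<tau> y \<noteq> \<tau> z" "\<tau> x \<noteq> \<tau> z" using \<tau>inj xyz by blast+
    then consider "\<tau> x < \<tau> y" "\<tau> y < \<tau> z" | "\<tau> x < \<tau> z" "\<tau> z < \<tau> y" | "\<tau> y < \<tau> x" "\<tau> x < \<tau> z"
      | "\<tau> y < \<tau> z" "\<tau> z < \<tau> x" | "\<tau> z < \<tau> x" "\<tau> x < \<tau> y" | "\<tau> z < \<tau> y" "\<tau> y < \<tau> x"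
      by linarith
    thus ?thesis using mid xyz(1-3) by cases blast+
  qed
  then obtain t\<^sub>0 where t0: "t\<^sub>0 \<in> {a<..<b}" "\<tau> t\<^sub>0 \<in> interior (pre Q')" by blast
  define s\<^sub>0 where "s\<^sub>0 = \<tau> t\<^sub>0"
  have int: "t\<^sub>0 \<in> interior D" "s\<^sub>0 \<in> interior D"
    using abQ[OF t0(1)] t0(2) interior_pre by (auto simp: s\<^sub>0_def)
  have "(t\<^sub>0, s\<^sub>0) \<in> germ g"
  proof (rule germI[OF int])
    fix \<epsilon> :: real assume \<epsilon>: "\<epsilon> > 0"
    define N where "N = interior (pre Q') \<inter> ball s\<^sub>0 \<epsilon>"
    have N: "open N" "N \<subseteq> pre Q'" "s\<^sub>0 \<in> N"
      using interior_subset t0(2) \<epsilon> by (auto simp: N_def s\<^sub>0_def)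
    have ND: "N \<subseteq> interior D" using N pre_subset by (meson interior_maximal order_trans)
    have "openin (top_of_set D) N" using N(1) ND interior_subset by (intro open_subset) blast+
    hence "openin (underlying S) (\<upsilon> ` N)"
      using homeomorphic_map_openness_eq[OF homeo] by blast
    hence "openin (subtopology (underlying S) Q') (\<upsilon> ` N)"
      using N(2) by (auto simp: openin_subtopology pre_def)
    \<comment> \<open>As \<open>\<iota>\<close> is an embedding on \<open>Q'\<close>, an open set
      \<open>V\<close> cuts the image of \<open>N\<close> out of the image of \<open>Q'\<close>.
      Parameters close to \<open>t\<^sub>0\<close> are mapped into \<open>V\<close>, so their
      matches lie in \<open>N\<close>.\<close>
    moreover have "open_map (subtopology (underlying S) Q')
        (subtopology (underlying M) (\<iota> ` topspace (subtopology (underlying S) Q'))) \<iota>"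
      using emb unfolding embedding_map_def by (rule homeomorphic_imp_open_map)
    ultimately have "openin (subtopology (underlying M) (\<iota> ` topspace (subtopology (underlying S) Q'))) (\<iota> ` \<upsilon> ` N)"
      unfolding open_map_def by blast
    moreover have "topspace (subtopology (underlying S) Q') = Q'"
      using segment_pre(1)[OF Q'(1)] by auto
    ultimately obtain V where V: "openin (underlying M) V" "\<iota> ` \<upsilon> ` N = V \<inter> \<iota> ` Q'"
      unfolding openin_subtopology by auto
    have "\<phi> g (\<gamma> t\<^sub>0) = \<gamma> s\<^sub>0" using \<tau>[OF t0(1)] by (simp add: s\<^sub>0_def)
    also have "\<dots> \<in> \<iota> ` \<upsilon> ` N" using N(3) by (auto simp: \<gamma>_def)
    finally have "\<phi> g (\<gamma> t\<^sub>0) \<in> V" using V(2) by blast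
    hence "\<forall>\<^sub>F t in nhds t\<^sub>0. (t \<in> interior D \<and> \<phi> g (\<gamma> t) \<in> V) \<and> t \<in> {a<..<b} \<inter> ball t\<^sub>0 \<epsilon>"
      using int t0(1) \<epsilon> V(1)
      by (intro eventually_conj eventually_continuous_map_interior[OF continuous_map_\<phi>\<gamma>[OF g]]
            eventually_nhds_in_open) auto
    hence "\<forall>\<^sub>F t in at t\<^sub>0. \<phi> g (\<gamma> t) \<in> V \<and> t \<in> {a<..<b} \<and> t \<in> ball t\<^sub>0 \<epsilon> \<and> t \<noteq> t\<^sub>0"
      unfolding eventually_at_filter by eventually_elim blast
    then obtain t where t: "\<phi> g (\<gamma> t) \<in> V" "t \<in> {a<..<b}" "t \<in> ball t\<^sub>0 \<epsilon>" "t \<noteq> t\<^sub>0"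
      using eventually_happens'[OF at_neq_bot] by blast
    have "\<phi> g (\<gamma> t) \<in> \<iota> ` Q'" using \<tau>[OF t(2)] by (auto simp: \<gamma>_def pre_def)
    hence "\<phi> g (\<gamma> t) \<in> \<iota> ` \<upsilon> ` N" using t(1) V(2) by blast
    then obtain s where s: "s \<in> N" "\<phi> g (\<gamma> t) = \<gamma> s" by (auto simp: \<gamma>_def)
    have "(t, s) \<in> matches g"
      using s ND abQ[OF t(2)] interior_pre by (auto simp: matches_def)
    thus "\<exists>t'\<in>ball t\<^sub>0 \<epsilon>. \<exists>s'\<in>ball s\<^sub>0 \<epsilon>. (t', s') \<noteq> (t\<^sub>0, s\<^sub>0) \<and> (t', s') \<in> matches g"
      using t s(1) by (intro bexI[of _ t] bexI[of _ s]) (auto simp: N_def)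
  qed
  moreover have "pre Q \<subseteq> pre \<Sigma>" "pre Q' \<subseteq> pre \<Sigma>'" using Q(2) Q'(2) by (auto simp: pre_def)
  hence "t\<^sub>0 \<in> interior (pre \<Sigma>)" "s\<^sub>0 \<in> interior (pre \<Sigma>')"
    using abQ[OF t0(1)] t0(2) interior_mono unfolding s\<^sub>0_def by blast+
  ultimately show thesis using that by blast
qed

text \<open>Extension of the germ defines a matching map \<open>\<sigma>\<close> on an interval
  around \<open>t\<^sub>0\<close>. It is continuous and injective, so its image is an open interval.
  Both intervals lie in compact balls inside the segments, which gives the embedding
  conditions.\<close>

lemma germ_overlaps:
  assumes g: "g \<in> carrier G" and ts: "(t\<^sub>0, s\<^sub>0) \<in> germ g"
    and t0: "t\<^sub>0 \<in> interior (pre \<Sigma>)" and s0: "s\<^sub>0 \<in> interior (pre \<Sigma>')"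
  shows "overlaps \<phi> M S \<iota> g \<Sigma> \<Sigma>'"
proof -
  obtain \<delta> where \<delta>: "\<delta> > 0" "cball s\<^sub>0 \<delta> \<subseteq> interior (pre \<Sigma>')"
    using s0 open_contains_cball open_interior by blast
  obtain e\<^sub>1 where e1: "e\<^sub>1 > 0" "cball t\<^sub>0 e\<^sub>1 \<subseteq> interior (pre \<Sigma>)"
    using t0 open_contains_cball open_interior by blast
  obtain e\<^sub>2 where e2: "e\<^sub>2 > 0" "\<And>t. t \<in> ball t\<^sub>0 e\<^sub>2 \<Longrightarrow> \<exists>s\<in>ball s\<^sub>0 \<delta>. (t, s) \<in> germ g"
    using germ_extend[OF g ts \<delta>(1)] unfolding eventually_nhds_metric by (metis dist_commute mem_ball)
  define \<epsilon> where "\<epsilon> = min e\<^sub>1 e\<^sub>2"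
  define I where "I = ball t\<^sub>0 \<epsilon>"
  have \<epsilon>: "\<epsilon> > 0" "cball t\<^sub>0 \<epsilon> \<subseteq> interior (pre \<Sigma>)" using e1 e2 by (auto simp: \<epsilon>_def)
  have ID: "I \<subseteq> pre \<Sigma>" "I \<subseteq> D" using \<epsilon>(2) interior_subset pre_subset by (fastforce simp: I_def)+
  have "\<forall>t\<in>I. \<exists>s. s \<in> ball s\<^sub>0 \<delta> \<and> (t, s) \<in> germ g"
    using e2(2) unfolding I_def \<epsilon>_def by (metis mem_ball min_less_iff_conj)
  then obtain \<sigma> where \<sigma>: "\<And>t. t \<in> I \<Longrightarrow> \<sigma> t \<in> ball s\<^sub>0 \<delta>" "\<And>t. t \<in> I \<Longrightarrow> (t, \<sigma> t) \<in> germ g"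
    by metis
  \<comment> \<open>Continuity follows from uniqueness: extension at \<open>t\<close> provides a
    match of \<open>t'\<close> near \<open>\<sigma> t\<close>, and this match can only be
    \<open>\<sigma> t'\<close>.\<close>
  have cont: "continuous_on I \<sigma>"
    unfolding continuous_on_iff
  proof (intro ballI allI impI)
    fix t \<eta> :: real assume t: "t \<in> I" and \<eta>: "\<eta> > 0"
    obtain d where d: "d > 0" "\<And>t'. dist t' t < d \<Longrightarrow> \<exists>s\<in>ball (\<sigma> t) \<eta>. (t', s) \<in> matches g"
      using germ_extend_matches[OF g \<sigma>(2)[OF t] \<eta>] unfolding eventually_nhds_metric by blast
    have "dist (\<sigma> t') (\<sigma> t) < \<eta>" if t': "t' \<in> I" "dist t' t < d" for t'
    proof -
      obtain s where s: "s \<in> ball (\<sigma> t) \<eta>" "(t', s) \<in> matches g" using d(2)[OF t'(2)] by blast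
      have "s = \<sigma> t'" using matches_unique[OF s(2) germ_matches[OF g \<sigma>(2)[OF t'(1)]]] .
      thus ?thesis using s(1) by (simp add: dist_commute)
    qed
    thus "\<exists>d>0. \<forall>t'\<in>I. dist t' t < d \<longrightarrow> dist (\<sigma> t') (\<sigma> t) < \<eta>" using d(1) by blast
  qed
  have inj: "inj_on \<sigma> I"
    using \<sigma>(2) germ_matches[OF g] matches_inj[OF g] by (metis inj_onI)
  have "open (\<sigma> ` I)"
    using cont inj by (intro injective_into_1d_imp_open_map_UNIV) (auto simp: I_def)
  have "connected (\<sigma> ` I)"
    using cont by (rule connected_continuous_image) (simp add: I_def)
  have \<sigma>I: "\<sigma> ` I \<subseteq> cball s\<^sub>0 \<delta>" using \<sigma>(1) by (auto simp: less_imp_le)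
  have \<sigma>pre: "\<sigma> ` I \<subseteq> pre \<Sigma>'" using \<sigma>I \<delta>(2) interior_subset by blast
  obtain a b where ab: "a \<in> I" "b \<in> I" "a \<noteq> b"
    using \<epsilon>(1) that[of t\<^sub>0 "t\<^sub>0 + \<epsilon> / 2"] by (auto simp: I_def dist_real_def)
  show ?thesis
    unfolding overlaps_def
  proof (rule exI[of _ "\<upsilon> ` I"], rule exI[of _ "\<upsilon> ` \<sigma> ` I"], intro conjI)
    show "\<upsilon> ` I \<in> segments S" "openin (underlying S) (\<upsilon> ` I)"
      using open_segmentI[OF _ _ ID(2) ab] by (auto simp: I_def)
    have "\<sigma> ` I \<subseteq> D" using \<sigma>pre pre_subset by blast
    moreover have "\<sigma> a \<noteq> \<sigma> b" using inj ab by (auto dest: inj_onD)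
    ultimately show "\<upsilon> ` \<sigma> ` I \<in> segments S" "openin (underlying S) (\<upsilon> ` \<sigma> ` I)"
      using open_segmentI[OF \<open>open (\<sigma> ` I)\<close> \<open>connected (\<sigma> ` I)\<close> _ imageI[OF ab(1)] imageI[OF ab(2)]] by blast+
    show "\<upsilon> ` I \<subseteq> \<Sigma>" using ID by (auto simp: pre_def)
    show "\<upsilon> ` \<sigma> ` I \<subseteq> \<Sigma>'" using \<sigma>pre by (auto simp: pre_def)
    show "embedding_map (subtopology (underlying S) (\<upsilon> ` I)) (underlying M) \<iota>"
    proof (rule embedding_map_compact[where C = "cball t\<^sub>0 \<epsilon>"])
      show "cball t\<^sub>0 \<epsilon> \<subseteq> D" using \<epsilon>(2) interior_subset pre_subset by blast
      show "\<upsilon> ` I \<subseteq> \<upsilon> ` cball t\<^sub>0 \<epsilon>" unfolding I_def by (rule image_mono[OF ball_subset_cball])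
    qed (rule compact_cball)
    show "embedding_map (subtopology (underlying S) (\<upsilon> ` \<sigma> ` I)) (underlying M) \<iota>"
    proof (rule embedding_map_compact[where C = "cball s\<^sub>0 \<delta>"])
      show "cball s\<^sub>0 \<delta> \<subseteq> D" using \<delta>(2) interior_subset pre_subset by blast
      show "\<upsilon> ` \<sigma> ` I \<subseteq> \<upsilon> ` cball s\<^sub>0 \<delta>" by (rule image_mono[OF \<sigma>I])
    qed (rule compact_cball)
    have "\<phi> g (\<gamma> t) = \<gamma> (\<sigma> t)" if "t \<in> I" for t
      using germ_matches[OF g \<sigma>(2)[OF that]] by (simp add: matches_def)
    thus "\<phi> g ` \<iota> ` \<upsilon> ` I = \<iota> ` \<upsilon> ` \<sigma> ` I"
      unfolding image_image \<gamma>_def by (intro image_cong) auto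
  qed
qed

text \<open>Through this form, freeness can be used without reference to open subsegments and
  embeddings.\<close>

lemma free_segment_germ:
  assumes "\<Sigma> \<in> free_segments G \<phi> M S \<iota>" "g \<in> carrier G" "(t, s) \<in> germ g"
    and "t \<in> interior (pre \<Sigma>)" "s \<in> interior (pre \<Sigma>)"
  shows "g \<in> Stab"
  using assms germ_overlaps by (auto simp: free_segments_def)

end

section \<open>Decompositions in the parameter interval\<close>

text \<open>If both intervals had a point on the same side of \<open>c\<close>, the one closer to
  \<open>c\<close> would lie in both.\<close>

lemma two_intervals_meeting_in_point:
  fixes X Y :: "real set"
  assumes X: "is_interval X" and Y: "is_interval Y" and XY: "X \<inter> Y = {c}"
    and a: "a \<in> X" "a \<noteq> c" and b: "b \<in> Y" "b \<noteq> c"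
  shows "X = (X \<union> Y) \<inter> {..c} \<and> Y = (X \<union> Y) \<inter> {c..} \<or> X = (X \<union> Y) \<inter> {c..} \<and> Y = (X \<union> Y) \<inter> {..c}"
proof -
  have c: "c \<in> X" "c \<in> Y" using XY by auto
  have below: False if "x \<in> X" "y \<in> Y" "x < c" "y < c" for x y
  proof (cases "x \<le> y")
    case True
    hence "y \<in> X" using mem_is_interval_1_I[OF X that(1) c(1), of y] that by simp
    thus False using XY that by auto
  next
    case False
    hence "x \<in> Y" using mem_is_interval_1_I[OF Y that(2) c(2), of x] that by simp
    thus False using XY that by auto
  qed
  have above: False if "x \<in> X" "y \<in> Y" "c < x" "c < y" for x y
  proof (cases "x \<le> y")
    case True
    hence "x \<in> Y" using mem_is_interval_1_I[OF Y c(2) that(2), of x] that by simp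
    thus False using XY that by auto
  next
    case False
    hence "y \<in> X" using mem_is_interval_1_I[OF X c(1) that(1), of y] that by simp
    thus False using XY that by auto
  qed
  show ?thesis
  proof (cases "a < c")
    case True
    hence Yc: "y \<ge> c" if "y \<in> Y" for y using below[OF a(1) that] by force
    hence "b > c" using b by force
    hence "x \<le> c" if "x \<in> X" for x using above[OF that b(1)] by force
    thus ?thesis using Yc c by (intro disjI1) force
  next
    case False
    hence "a > c" using a(2) by simp
    hence Yc: "y \<le> c" if "y \<in> Y" for y using above[OF a(1) that] by force
    hence "b < c" using b by force
    hence "x \<ge> c" if "x \<in> X" for x using below[OF that b(1)] by force
    thus ?thesis using Yc c by (intro disjI2) force
  qed
qed

text \<open>A z-decomposition seen in the parameter interval, with \<open>c\<close> the parameter of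
  \<open>z\<close> and \<open>A\<close>, \<open>B\<close> the open halves. Both orders are allowed
  in \<open>sides\<close>, so the setting is symmetric and each statement about \<open>A\<close>
  holds for \<open>B\<close> by \<open>decomposition_swap\<close>.\<close>

locale decomposition = curve_action +
  fixes c :: real and g :: 'a and A B :: "real set"
  assumes g: "g \<in> carrier G" and g_nontrivial: "g \<notin> Stab" and germ_c: "(c, c) \<in> germ g"
    and sides: "A = interior D \<inter> {..<c} \<and> B = interior D \<inter> {c<..} \<or>
                A = interior D \<inter> {c<..} \<and> B = interior D \<inter> {..<c}"
    and free_A: "h \<in> carrier G \<Longrightarrow> (t, s) \<in> germ h \<Longrightarrow> t \<in> A \<Longrightarrow> s \<in> A \<Longrightarrow> h \<in> Stab"
    and free_B: "h \<in> carrier G \<Longrightarrow> (t, s) \<in> germ h \<Longrightarrow> t \<in> B \<Longrightarrow> s \<in> B \<Longrightarrow> h \<in> Stab"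
begin

lemma decomposition_swap: "decomposition G M \<phi> S \<iota> D \<upsilon> c g B A"
  using curve_action_axioms g g_nontrivial germ_c sides free_A free_B
  by (auto simp: decomposition_def decomposition_axioms_def)

lemma c_interior: "c \<in> interior D"
  using germ_interior[OF germ_c] by simp

lemma interior_D_cases:
  assumes "t \<in> interior D"
  obtains "t \<in> A" | "t = c" | "t \<in> B"
  using assms sides by fastforce

text \<open>A second parameter in \<open>B\<close> would put \<open>g\<close> into
  \<open>Stab\<close> by freeness, and the second parameter \<open>c\<close> would force
  \<open>t = c\<close>.\<close>

lemma germ_g_B:
  assumes ts: "(t, s) \<in> germ g" and t: "t \<in> B"
  shows "s \<in> A"
proof -
  have "s \<in> interior D" using germ_interior[OF ts] by simp
  moreover have "s \<notin> B" using free_B[OF g ts t] g_nontrivial by blast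
  moreover have "s \<noteq> c"
  proof
    assume "s = c"
    hence "t = c" using matches_inj[OF g] germ_matches[OF g ts] germ_matches[OF g germ_c] by blast
    thus False using t sides by auto
  qed
  ultimately show "s \<in> A" by (metis interior_D_cases)
qed

lemma germ_g_A: "(t, s) \<in> germ g \<Longrightarrow> t \<in> A \<Longrightarrow> s \<in> B"
  using decomposition.germ_g_B[OF decomposition_swap] by blast

text \<open>Two steps along germs of \<open>g\<close> start and end on the same side of
  \<open>c\<close>, so freeness of that side applies to the square.\<close>

lemma square_Stab: "g \<otimes>\<^bsub>G\<^esub> g \<in> Stab"
proof -
  \<comment> \<open>Every parameter within \<open>d\<close> of \<open>c\<close> starts a germ of
    \<open>g\<close>; the second extension keeps the intermediate parameter \<open>s\<close> within
    this distance.\<close>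
  obtain d where d: "d > 0" "\<And>t. dist t c < d \<Longrightarrow> \<exists>s. (t, s) \<in> germ g"
    using germ_extend[OF g germ_c zero_less_one] unfolding eventually_nhds_metric by blast
  have "\<forall>\<^sub>F t in nhds c. \<exists>s\<in>ball c d. (t, s) \<in> germ g"
    by (rule germ_extend[OF g germ_c d(1)])
  hence "\<forall>\<^sub>F t in at c. t \<noteq> c \<and> (\<exists>s\<in>ball c d. (t, s) \<in> germ g)"
    unfolding eventually_at_filter by eventually_elim blast
  then obtain t s where ts: "t \<noteq> c" "s \<in> ball c d" "(t, s) \<in> germ g"
    using eventually_happens'[OF at_neq_bot] by blast
  obtain u where u: "(s, u) \<in> germ g" using d(2)[of s] ts(2) by (auto simp: dist_commute)
  have tu: "(t, u) \<in> germ (g \<otimes>\<^bsub>G\<^esub> g)" by (rule germ_mult[OF g g ts(3) u])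
  have gg: "g \<otimes>\<^bsub>G\<^esub> g \<in> carrier G" using group_G g by (simp add: group.is_monoid monoid.m_closed)
  from germ_interior[OF ts(3)] ts(1) consider "t \<in> A" | "t \<in> B" using interior_D_cases by blast
  thus ?thesis
  proof cases
    case 1
    thus ?thesis using free_A[OF gg tu] germ_g_A[OF ts(3)] germ_g_B[OF u] by blast
  next
    case 2
    thus ?thesis using free_B[OF gg tu] germ_g_B[OF ts(3)] germ_g_A[OF u] by blast
  qed
qed

text \<open>\<open>g\<close> is its inverse times its square, and the square lies in
  \<open>Stab\<close>, so a germ of the inverse is also one of \<open>g\<close>.\<close>

lemma germ_g_sym:
  assumes ts: "(t, s) \<in> germ g"
  shows "(s, t) \<in> germ g"
proof -
  interpret group G by (rule group_G)
  have "(s, s) \<in> germ (g \<otimes>\<^bsub>G\<^esub> g)"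
    using germ_Stab[OF square_Stab] germ_interior[OF ts] by blast
  hence "(s, t) \<in> germ (inv\<^bsub>G\<^esub> g \<otimes>\<^bsub>G\<^esub> (g \<otimes>\<^bsub>G\<^esub> g))"
    using g by (intro germ_mult[OF _ _ _ germ_inv[OF g ts]]) auto
  thus ?thesis using g by (simp add: m_assoc[symmetric])
qed

text \<open>Distance to \<open>c\<close> serves as coordinate on the half \<open>A\<close>, so that
  it need not be known whether \<open>A\<close> is the left or the right half.\<close>

lemma closed_segment_A:
  assumes t: "t \<in> A"
  shows "closed_segment c t = {y \<in> insert c A. \<bar>y - c\<bar> \<le> \<bar>t - c\<bar>}"
proof -
  have "convex (interior D)"
    using parametrization by (intro convex_interior) (simp add: interval_parametrization_def is_interval_convex_1)
  hence "closed_segment c t \<subseteq> interior D"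
    using t sides c_interior by (intro closed_segment_subset) auto
  thus ?thesis using sides t by (auto simp: closed_segment_eq_real_ivl split: if_splits)
qed

lemma closed_segment_B: "t \<in> B \<Longrightarrow> closed_segment c t = {y \<in> insert c B. \<bar>y - c\<bar> \<le> \<bar>t - c\<bar>}"
  by (rule decomposition.closed_segment_A[OF decomposition_swap])

text \<open>The germ through \<open>(c, c)\<close> extends until its first or its second coordinate leaves \<open>D\<close>.\<close>

lemma germ_g_reaches:
  assumes s: "s \<in> B" and t: "t \<in> A"
  shows "(\<exists>u. (s, u) \<in> germ g) \<or> (\<exists>u. (t, u) \<in> germ g)"
proof (rule ccontr)
  assume neg: "\<not> ?thesis"
  define K L where "K = closed_segment c s" and "L = closed_segment c t"
  \<comment> \<open>The parameters in \<open>K\<close> that germs of \<open>g\<close> match into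
    \<open>L\<close>. A connectedness argument shows that they fill \<open>K\<close>, contrary to
    the assumption on \<open>s\<close>.\<close>
  define X where "X = {x \<in> K. \<exists>y\<in>L. (x, y) \<in> germ g}"
  have int: "K \<subseteq> interior D" "L \<subseteq> interior D"
    using closed_segment_A[OF t] closed_segment_B[OF s] sides c_interior by (auto simp: K_def L_def)
  \<comment> \<open>Limit points of \<open>matches g\<close> in the compact set
    \<open>K \<times> L\<close> form a compact set, and \<open>X\<close> is its projection.\<close>
  have "X = fst ` ({p. p islimpt matches g} \<inter> (K \<times> L))"
    using int by (force simp: X_def germ_def)
  moreover have "compact (fst ` ({p. p islimpt matches g} \<inter> (K \<times> L)))"
    unfolding K_def L_def
    by (intro compact_continuous_image continuous_on_fst continuous_on_id
        closed_Int_compact compact_Times closed_limpts compact_segment)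
  ultimately have "closed X" by (simp add: compact_imp_closed)
  hence "closedin (top_of_set K) X" by (intro closed_subset) (auto simp: X_def)
  moreover have "openin (top_of_set K) X"
    unfolding openin_euclidean_subtopology_iff
  proof (intro conjI ballI)
    show "X \<subseteq> K" by (auto simp: X_def)
    fix x assume "x \<in> X"
    then obtain y where xy: "x \<in> K" "y \<in> L" "(x, y) \<in> germ g" by (auto simp: X_def)
    \<comment> \<open>By symmetry of germs, \<open>y = t\<close> would give a germ starting in
      \<open>t\<close>. So \<open>y\<close> is strictly closer to \<open>c\<close> than
      \<open>t\<close>, and the difference is the room for an extension within
      \<open>L\<close>.\<close>
    have "y \<noteq> t" using neg germ_g_sym xy(3) by blast
    moreover have "y \<in> insert c A" "\<bar>y - c\<bar> \<le> \<bar>t - c\<bar>"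
      using xy(2) closed_segment_A[OF t] by (auto simp: L_def)
    ultimately have "\<bar>y - c\<bar> < \<bar>t - c\<bar>" using t sides by auto
    then obtain d where d: "d > 0"
      "\<And>x'. dist x' x < d \<Longrightarrow> \<exists>y'\<in>ball y (\<bar>t - c\<bar> - \<bar>y - c\<bar>). (x', y') \<in> germ g"
      using germ_extend[OF g xy(3), of "\<bar>t - c\<bar> - \<bar>y - c\<bar>"] unfolding eventually_nhds_metric by auto
    have "x' \<in> X" if x': "x' \<in> K" "dist x' x < d" for x'
    proof -
      obtain y' where y': "y' \<in> ball y (\<bar>t - c\<bar> - \<bar>y - c\<bar>)" "(x', y') \<in> germ g"
        using d(2)[OF x'(2)] by blast
      \<comment> \<open>Germs of \<open>g\<close> lead from \<open>B\<close> to \<open>A\<close> and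
        from \<open>c\<close> only to \<open>c\<close>, so the extension stays on the side of
        \<open>L\<close> and only the distance to \<open>c\<close> has to be bounded.\<close>
      have "x' \<in> insert c B" using x'(1) closed_segment_B[OF s] by (auto simp: K_def)
      hence "y' \<in> insert c A"
        using germ_g_B[OF y'(2)] germ_matches[OF g y'(2)] matches_unique germ_matches[OF g germ_c] by blast
      moreover have "\<bar>y' - c\<bar> \<le> \<bar>t - c\<bar>" using y'(1) by (auto simp: dist_real_def)
      ultimately have "y' \<in> L" using closed_segment_A[OF t] by (auto simp: L_def)
      thus "x' \<in> X" using x'(1) y'(2) by (auto simp: X_def)
    qed
    thus "\<exists>e>0. \<forall>x'\<in>K. dist x' x < e \<longrightarrow> x' \<in> X" using d(1) by blast
  qed
  moreover have "connected K" by (simp add: K_def)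
  moreover have "c \<in> X" using germ_c by (auto simp: X_def K_def L_def)
  ultimately have "X = K" unfolding connected_clopen by blast
  hence "s \<in> X" by (simp add: K_def)
  thus False using neg by (auto simp: X_def)
qed

text \<open>If the germ of \<open>h\<close> stays in \<open>A\<close>, freeness applies directly. If
  it leads to \<open>B\<close>, a germ of \<open>g\<close> at one of its two ends moves that end to
  the side of the other, and freeness applies to a product of \<open>g\<close> and
  \<open>h\<close>.\<close>

lemma germ_from_A:
  assumes h: "h \<in> carrier G" and ts: "(t, s) \<in> germ h" and t: "t \<in> A"
  shows "h \<in> Stab \<or> inv\<^bsub>G\<^esub> g \<otimes>\<^bsub>G\<^esub> h \<in> Stab"
proof -
  interpret group G by (rule group_G)
  have "open A" using sides by (auto intro: open_Int)
  \<comment> \<open>A small move of \<open>t\<close> inside the open set \<open>A\<close> avoids the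
    second parameter \<open>c\<close>, since \<open>h\<close> matches at most one parameter with
    \<open>c\<close>.\<close>
  have "\<forall>\<^sub>F t' in nhds t. (\<exists>s'\<in>ball s 1. (t', s') \<in> germ h) \<and> t' \<in> A"
    using t \<open>open A\<close> by (intro eventually_conj germ_extend[OF h ts] eventually_nhds_in_open) auto
  hence "\<forall>\<^sub>F t' in at t. (\<exists>s'. (t', s') \<in> germ h) \<and> t' \<in> A \<and> t' \<noteq> t"
    unfolding eventually_at_filter by eventually_elim blast
  then obtain t' s' where ts': "(t', s') \<in> germ h" "t' \<in> A" "t' \<noteq> t"
    using eventually_happens'[OF at_neq_bot] by blast
  have "s' \<noteq> c \<or> s \<noteq> c"
    using ts' matches_inj[OF h] germ_matches[OF h ts] germ_matches[OF h ts'(1)] by blast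
  then obtain t s where ts: "(t, s) \<in> germ h" "t \<in> A" "s \<noteq> c"
    using ts t ts' by blast
  from germ_interior[OF ts(1)] ts(3) consider "s \<in> A" | "s \<in> B" using interior_D_cases by blast
  thus ?thesis
  proof cases
    case 1
    thus ?thesis using free_A[OF h ts(1,2)] by blast
  next
    case 2
    from germ_g_reaches[OF 2 ts(2)] show ?thesis
    proof (elim disjE exE)
      \<comment> \<open>The product \<open>g \<otimes> h\<close> leads from \<open>t\<close> back to
        \<open>A\<close>. Multiplying it by the inverse of the square of \<open>g\<close>, an
        element of \<open>Stab\<close>, leaves the quotient that is wanted.\<close>
      fix u assume u: "(s, u) \<in> germ g"
      have "(t, u) \<in> germ (g \<otimes>\<^bsub>G\<^esub> h)" by (rule germ_mult[OF h g ts(1) u])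
      hence "g \<otimes>\<^bsub>G\<^esub> h \<in> Stab" 
        by (rule free_A[rotated, OF _ ts(2) germ_g_B[OF u 2]]) (use g h in simp)
      hence "inv\<^bsub>G\<^esub> (g \<otimes>\<^bsub>G\<^esub> g) \<otimes>\<^bsub>G\<^esub> (g \<otimes>\<^bsub>G\<^esub> h) \<in> Stab"
        using square_Stab subgroup_Stab by (simp add: subgroup.m_closed subgroup.m_inv_closed)
      also have "inv\<^bsub>G\<^esub> (g \<otimes>\<^bsub>G\<^esub> g) \<otimes>\<^bsub>G\<^esub> (g \<otimes>\<^bsub>G\<^esub> h) = inv\<^bsub>G\<^esub> g \<otimes>\<^bsub>G\<^esub> h"
        using g h by (simp add: inv_mult_group m_assoc inv_solve_left' flip: m_assoc[of "inv\<^bsub>G\<^esub> g" g h])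
      finally show ?thesis ..
    next
      fix u assume u: "(t, u) \<in> germ g"
      have ut: "(u, t) \<in> germ (inv\<^bsub>G\<^esub> g)" "(t, u) \<in> germ (inv\<^bsub>G\<^esub> g)"
        using germ_inv[OF g] germ_g_sym u by blast+
      have uB: "u \<in> B" by (rule germ_g_A[OF u ts(2)])
      have "(u, s) \<in> germ (h \<otimes>\<^bsub>G\<^esub> g)" by (rule germ_mult[OF g h germ_g_sym[OF u] ts(1)])
      hence hg: "h \<otimes>\<^bsub>G\<^esub> g \<in> Stab" by (rule free_B[rotated, OF _ uB 2]) (use g h in simp)
      \<comment> \<open>So far only the product with \<open>g\<close> on the right is known to lie
        in \<open>Stab\<close>, and \<open>Stab\<close> is not known to be normal. The quotient in
        the order wanted is therefore shown to have a germ at \<open>(t, t)\<close>, where freeness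
        of \<open>A\<close> applies.\<close>
      have "(u, u) \<in> germ (h \<otimes>\<^bsub>G\<^esub> g)" using germ_Stab[OF hg] germ_interior[OF u] by blast
      hence "(t, u) \<in> germ (h \<otimes>\<^bsub>G\<^esub> g \<otimes>\<^bsub>G\<^esub> inv\<^bsub>G\<^esub> g)" using g h by (intro germ_mult[OF _ _ ut(2)]) auto
      hence "(t, u) \<in> germ h" using g h by (simp add: m_assoc)
      hence "(t, t) \<in> germ (inv\<^bsub>G\<^esub> g \<otimes>\<^bsub>G\<^esub> h)" using g h by (intro germ_mult[OF _ _ _ ut(1)]) auto
      hence "inv\<^bsub>G\<^esub> g \<otimes>\<^bsub>G\<^esub> h \<in> Stab" 
        by (rule free_A[rotated, OF _ ts(2,2)]) (use g h in simp)
      thus ?thesis ..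
    qed
  qed
qed

lemma coset_class_germ_from_A:
  assumes "h \<in> carrier G" "(t, s) \<in> germ h" "t \<in> A"
  shows "coset_class G \<phi> S \<iota> h \<in> {coset_class G \<phi> S \<iota> \<one>\<^bsub>G\<^esub>, coset_class G \<phi> S \<iota> g}"
  using germ_from_A[OF assms] coset_class_one_iff[OF assms(1)] coset_class_eqI[OF g assms(1)] by blast

lemma coset_class_inv: "coset_class G \<phi> S \<iota> (inv\<^bsub>G\<^esub> g) = coset_class G \<phi> S \<iota> g"
proof (rule coset_class_eqI[OF g])
  interpret group G by (rule group_G)
  show "inv\<^bsub>G\<^esub> g \<in> carrier G" using g by simp
  have "inv\<^bsub>G\<^esub> (g \<otimes>\<^bsub>G\<^esub> g) \<in> Stab"
    using square_Stab subgroup_Stab by (simp add: subgroup.m_inv_closed)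
  thus "inv\<^bsub>G\<^esub> g \<otimes>\<^bsub>G\<^esub> inv\<^bsub>G\<^esub> g \<in> Stab" using g by (simp add: inv_mult_group)
qed

text \<open>The germ continues from \<open>c\<close> to a parameter in one of the halves, where
  germs are already classified. This gives uniqueness of the class once the base points
  agree.\<close>

lemma coset_class_germ_c:
  assumes h: "h \<in> carrier G" and "h \<notin> Stab" and c: "(c, c) \<in> germ h"
  shows "coset_class G \<phi> S \<iota> h = coset_class G \<phi> S \<iota> g"
proof -
  have "\<forall>\<^sub>F t in nhds c. \<exists>s\<in>ball c 1. (t, s) \<in> germ h"
    by (rule germ_extend[OF h c zero_less_one])
  hence "\<forall>\<^sub>F t in at c. t \<noteq> c \<and> (\<exists>s. (t, s) \<in> germ h)"
    unfolding eventually_at_filter by eventually_elim blast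
  then obtain t s where ts: "t \<noteq> c" "(t, s) \<in> germ h"
    using eventually_happens'[OF at_neq_bot] by blast
  from germ_interior[OF ts(2)] ts(1) consider "t \<in> A" | "t \<in> B" using interior_D_cases by blast
  hence "coset_class G \<phi> S \<iota> h \<in> {coset_class G \<phi> S \<iota> \<one>\<^bsub>G\<^esub>, coset_class G \<phi> S \<iota> g}"
    using coset_class_germ_from_A[OF h ts(2)]
      decomposition.coset_class_germ_from_A[OF decomposition_swap h ts(2)] by cases auto
  thus ?thesis using coset_class_one_iff[OF h] assms(2) by blast
qed

end

section \<open>From z-decompositions to maximal free segments\<close>

context curve_action
begin

text \<open>The main point is the germ of \<open>g\<close> at \<open>(c, c)\<close>: parameters of
  \<open>Km\<close> converge to \<open>c\<close>, and the matching parameters lie in the compact set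
  \<open>pre Kp\<close>, so \<open>germI_sequentially\<close> applies.\<close>

lemma z_decomposition_imp_decomposition:
  assumes g: "g \<in> carrier G" and z: "z \<in> seg_interior D \<upsilon> (points S)"
    and dec: "z_decomposition G \<phi> M S \<iota> D \<upsilon> z g \<Sigma>m \<Sigma>p"
  obtains c where "\<upsilon> c = z" "pre \<Sigma>m \<inter> pre \<Sigma>p = {c}"
    "pre \<Sigma>m = D \<inter> {..c} \<and> pre \<Sigma>p = D \<inter> {c..} \<or> pre \<Sigma>m = D \<inter> {c..} \<and> pre \<Sigma>p = D \<inter> {..c}"
    "decomposition G M \<phi> S \<iota> D \<upsilon> c g (interior (pre \<Sigma>m)) (interior (pre \<Sigma>p))"
proof -
  have "pre (points S) = D" using image_\<upsilon> by (auto simp: pre_def)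
  then obtain c where c: "c \<in> interior D" "\<upsilon> c = z"
    using z by (auto simp: seg_interior_def pre_def)
  have cD: "c \<in> D" by (rule interior_D[OF c(1)])
  obtain Km Kp where K: "Km \<in> segments S" "Kp \<in> segments S" "compactin (underlying S) Kp"
      "\<phi> g ` \<iota> ` Km = \<iota> ` Kp" "Km \<inter> Kp = {z}"
    and cover: "points S = \<Sigma>m \<union> \<Sigma>p" "\<Sigma>m \<inter> \<Sigma>p = {z}"
    and free: "\<Sigma>m \<in> free_segments G \<phi> M S \<iota>" "\<Sigma>p \<in> free_segments G \<phi> M S \<iota>"
    and stab: "g \<in> stabilizer G \<phi> (\<iota> z)" and ne: "coset_class G \<phi> S \<iota> g \<noteq> coset_class G \<phi> S \<iota> \<one>\<^bsub>G\<^esub>"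
    using dec unfolding z_decomposition_def by (elim conjE exE) (rule that; assumption)
  have seg: "\<Sigma>m \<in> segments S" "\<Sigma>p \<in> segments S" using free by (auto simp: free_segments_def)
  have un: "pre \<Sigma>m \<union> pre \<Sigma>p = D" using cover(1) image_\<upsilon> by (auto simp: pre_def)
  have ic: "pre \<Sigma>m \<inter> pre \<Sigma>p = {c}"
  proof -
    have "pre \<Sigma>m \<inter> pre \<Sigma>p = {t \<in> D. \<upsilon> t \<in> \<Sigma>m \<inter> \<Sigma>p}" by (auto simp: pre_def)
    also have "\<dots> = {t \<in> D. \<upsilon> t = z}" by (simp add: cover(2))
    also have "\<dots> = {c}" using inj_onD[OF inj_\<upsilon> _ _ cD, unfolded c(2)] cD c(2) by blast
    finally show ?thesis .
  qed
  have other: "\<exists>a\<in>pre \<Sigma>. a \<noteq> c" if "\<Sigma> \<in> segments S" for \<Sigma>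
    using segment_pre(3)[OF that] by (metis less_irrefl)
  obtain a where a: "a \<in> pre \<Sigma>m" "a \<noteq> c" using other[OF seg(1)] by blast
  obtain b where b: "b \<in> pre \<Sigma>p" "b \<noteq> c" using other[OF seg(2)] by blast
  have sides: "pre \<Sigma>m = D \<inter> {..c} \<and> pre \<Sigma>p = D \<inter> {c..} \<or> pre \<Sigma>m = D \<inter> {c..} \<and> pre \<Sigma>p = D \<inter> {..c}"
    using two_intervals_meeting_in_point[OF segment_pre(2)[OF seg(1)] segment_pre(2)[OF seg(2)] ic a b]
    unfolding un .
  have gc: "\<phi> g (\<gamma> c) = \<gamma> c" using stab c(2) by (simp add: stabilizer_def \<gamma>_def)
  have cK: "c \<in> pre Km" using K(5) cD c(2) by (auto simp: pre_def)
  \<comment> \<open>A connected set with more than one point has no isolated points.\<close>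
  have "c islimpt pre Km"
  proof (rule connected_imp_perfect[OF _ cK])
    show "connected (pre Km)" using segment_pre(2)[OF K(1)] by (simp add: is_interval_connected_1)
    show "pre Km \<noteq> {a}" for a using segment_pre(3)[OF K(1)] by auto
  qed
  then obtain x where x: "\<And>n. x n \<in> pre Km - {c}" "x \<longlonglongrightarrow> c" unfolding islimpt_sequential by blast
  have "\<exists>y\<in>pre Kp. \<phi> g (\<gamma> (x n)) = \<gamma> y" for n
  proof -
    have "\<phi> g (\<gamma> (x n)) \<in> \<iota> ` \<upsilon> ` pre Kp"
      using x(1)[of n] K(4) image_pre[OF segment_pre(1)[OF K(2)]] by (auto simp: \<gamma>_def pre_def)
    thus ?thesis by (auto simp: \<gamma>_def)
  qed
  then obtain y where y: "\<And>n. y n \<in> pre Kp" "\<And>n. \<phi> g (\<gamma> (x n)) = \<gamma> (y n)" by metis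
  have "compactin (top_of_set D) (pre Kp)"
    using K(3) image_pre[OF segment_pre(1)[OF K(2)]] pre_subset homeomorphic_map_compactness_eq[OF homeo] by simp
  hence "compact (pre Kp)" by (simp add: compactin_subtopology)
  hence germ: "(c, c) \<in> germ g"
    using x y by (intro germI_sequentially[OF g c(1,1) gc _ _ x(2), of "pre Kp" y]) (auto simp: pre_def)
  have "g \<notin> Stab" using ne coset_class_one_iff[OF g] by blast
  moreover have "interior (pre \<Sigma>m) = interior D \<inter> {..<c} \<and> interior (pre \<Sigma>p) = interior D \<inter> {c<..} \<or>
      interior (pre \<Sigma>m) = interior D \<inter> {c<..} \<and> interior (pre \<Sigma>p) = interior D \<inter> {..<c}"
    using sides by (auto simp: interior_Int)
  ultimately have "decomposition G M \<phi> S \<iota> D \<upsilon> c g (interior (pre \<Sigma>m)) (interior (pre \<Sigma>p))"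
    using curve_action_axioms g germ free free_segment_germ
    by (auto simp: decomposition_def decomposition_axioms_def)
  thus thesis using that c(2) ic sides by blast
qed

text \<open>The germ of \<open>g\<close> at \<open>(c, c)\<close> keeps \<open>c\<close> out of the
  interior of every free segment, so a free segment lies in one of the halves. Neither half contains
  the other, as each has more than one point and they share only \<open>z\<close>.\<close>

lemma z_decomposition_maximal:
  assumes g: "g \<in> carrier G" and z: "z \<in> seg_interior D \<upsilon> (points S)"
    and dec: "z_decomposition G \<phi> M S \<iota> D \<upsilon> z g \<Sigma>m \<Sigma>p"
  shows "maximal_free_segments G \<phi> M S \<iota> = {\<Sigma>m, \<Sigma>p}"
proof -
  obtain c where c: "\<upsilon> c = z" "pre \<Sigma>m \<inter> pre \<Sigma>p = {c}"
    "pre \<Sigma>m = D \<inter> {..c} \<and> pre \<Sigma>p = D \<inter> {c..} \<or> pre \<Sigma>m = D \<inter> {c..} \<and> pre \<Sigma>p = D \<inter> {..c}"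
    "decomposition G M \<phi> S \<iota> D \<upsilon> c g (interior (pre \<Sigma>m)) (interior (pre \<Sigma>p))"
    by (rule z_decomposition_imp_decomposition[OF g z dec])
  interpret decomposition G M \<phi> S \<iota> D \<upsilon> c g "interior (pre \<Sigma>m)" "interior (pre \<Sigma>p)" by (rule c(4))
  have free: "\<Sigma>m \<in> free_segments G \<phi> M S \<iota>" "\<Sigma>p \<in> free_segments G \<phi> M S \<iota>"
    using dec unfolding z_decomposition_def by blast+
  have seg: "\<Sigma> \<in> segments S" if "\<Sigma> \<in> free_segments G \<phi> M S \<iota>" for \<Sigma>
    using that by (auto simp: free_segments_def)
  have sub: "\<Sigma> \<subseteq> \<Sigma>m \<or> \<Sigma> \<subseteq> \<Sigma>p" if \<Sigma>: "\<Sigma> \<in> free_segments G \<phi> M S \<iota>" for \<Sigma>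
  proof -
    have "c \<notin> interior (pre \<Sigma>)"
      using free_segment_germ[OF \<Sigma> g germ_c] g_nontrivial by blast
    hence "\<not> (\<exists>a\<in>pre \<Sigma>. \<exists>b\<in>pre \<Sigma>. a < c \<and> c < b)"
      using interior_interval_between[OF segment_pre(2)[OF seg[OF \<Sigma>]]] by blast
    hence "pre \<Sigma> \<subseteq> {..c} \<or> pre \<Sigma> \<subseteq> {c..}" by force
    hence "pre \<Sigma> \<subseteq> pre \<Sigma>m \<or> pre \<Sigma> \<subseteq> pre \<Sigma>p" using c(3) pre_subset[of \<Sigma>] by blast
    hence "\<upsilon> ` pre \<Sigma> \<subseteq> \<upsilon> ` pre \<Sigma>m \<or> \<upsilon> ` pre \<Sigma> \<subseteq> \<upsilon> ` pre \<Sigma>p" by blast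
    thus ?thesis by (simp add: image_pre segment_pre(1) seg \<Sigma> free)
  qed
  have "\<not> \<Sigma>m \<subseteq> \<Sigma>p"
  proof
    assume "\<Sigma>m \<subseteq> \<Sigma>p"
    hence "pre \<Sigma>m \<subseteq> {c}" using c(2) by (auto simp: pre_def)
    thus False using segment_pre(3)[OF seg[OF free(1)]] by (metis less_irrefl singletonD subsetD)
  qed
  moreover have "\<not> \<Sigma>p \<subseteq> \<Sigma>m"
  proof
    assume "\<Sigma>p \<subseteq> \<Sigma>m"
    hence "pre \<Sigma>p \<subseteq> {c}" using c(2) by (auto simp: pre_def)
    thus False using segment_pre(3)[OF seg[OF free(2)]] by (metis less_irrefl singletonD subsetD)
  qed
  ultimately have maxmp: "(\<Sigma>m \<subseteq> \<Sigma> \<longrightarrow> \<Sigma> = \<Sigma>m) \<and> (\<Sigma>p \<subseteq> \<Sigma> \<longrightarrow> \<Sigma> = \<Sigma>p)"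
    if "\<Sigma> \<in> free_segments G \<phi> M S \<iota>" for \<Sigma>
    using sub[OF that] by blast
  show ?thesis
  proof (intro equalityI subsetI)
    fix \<Sigma> assume "\<Sigma> \<in> maximal_free_segments G \<phi> M S \<iota>"
    hence \<Sigma>: "\<Sigma> \<in> free_segments G \<phi> M S \<iota>"
      and max: "\<And>\<Sigma>'. \<Sigma>' \<in> free_segments G \<phi> M S \<iota> \<Longrightarrow> \<Sigma> \<subseteq> \<Sigma>' \<Longrightarrow> \<Sigma>' = \<Sigma>"
      by (simp_all add: maximal_free_segments_def)
    show "\<Sigma> \<in> {\<Sigma>m, \<Sigma>p}"
      using sub[OF \<Sigma>] max[OF free(1)] max[OF free(2)] by blast
  next
    fix \<Sigma> assume "\<Sigma> \<in> {\<Sigma>m, \<Sigma>p}"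
    thus "\<Sigma> \<in> maximal_free_segments G \<phi> M S \<iota>"
      using free maxmp unfolding maximal_free_segments_def by blast
  qed
qed

end

section \<open>The four assertions about a z-decomposition\<close>

theorem lemma26:
  fixes G :: "('g, 'b) monoid_scheme" and L :: "'g manifold"
    and M :: "'m manifold" and \<phi> :: "'g \<Rightarrow> 'm \<Rightarrow> 'm"
    and S :: "'s manifold" and \<iota> :: "'s \<Rightarrow> 'm"
    and D :: "real set" and \<upsilon> :: "real \<Rightarrow> 's"
    and z :: 's and g :: 'g and \<Sigma>m \<Sigma>p :: "'s set"
  assumes "lie_group G L"
    and "analytic_manifold M"
    and "pointwise_continuous_action G L M \<phi>"
    and "non_contractive G M \<phi>"
    and "analytic_1_submanifold M S \<iota>"
    and "free_submfd G \<phi> M S \<iota>"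
    and "interval_parametrization S D \<upsilon>"
    and "points S \<notin> free_segments G \<phi> M S \<iota>"
    and "z \<in> seg_interior D \<upsilon> (points S)"
    and "g \<in> carrier G"
    and "z_decomposition G \<phi> M S \<iota> D \<upsilon> z g \<Sigma>m \<Sigma>p"
  shows "maximal_free_segments G \<phi> M S \<iota> = {\<Sigma>m, \<Sigma>p}
    \<and> (\<forall>g'\<in>carrier G. overlaps \<phi> M S \<iota> g' \<Sigma>m (points S) \<longrightarrow>
         coset_class G \<phi> S \<iota> g' \<in> {coset_class G \<phi> S \<iota> \<one>\<^bsub>G\<^esub>, coset_class G \<phi> S \<iota> g})
    \<and> coset_class G \<phi> S \<iota> (inv\<^bsub>G\<^esub> g) = coset_class G \<phi> S \<iota> g
    \<and> (\<forall>z'\<in>seg_interior D \<upsilon> (points S). \<forall>g'\<in>carrier G. \<forall>\<Sigma>m' \<Sigma>p'.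
         z_decomposition G \<phi> M S \<iota> D \<upsilon> z' g' \<Sigma>m' \<Sigma>p' \<longrightarrow>
         z' = z \<and> coset_class G \<phi> S \<iota> g' = coset_class G \<phi> S \<iota> g)"
proof -
  interpret curve_action G M \<phi> S \<iota> D \<upsilon>
    using assms(2-5,7)
    by (intro curve_action.intro) (simp_all add: pointwise_continuous_action_def non_contractive_def)
  note z = assms(9) and g = assms(10) and dec = assms(11)
  obtain c where c: "\<upsilon> c = z"
    and decomp: "decomposition G M \<phi> S \<iota> D \<upsilon> c g (interior (pre \<Sigma>m)) (interior (pre \<Sigma>p))"
    by (rule z_decomposition_imp_decomposition[OF g z dec])
  interpret decomposition G M \<phi> S \<iota> D \<upsilon> c g "interior (pre \<Sigma>m)" "interior (pre \<Sigma>p)"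
    by (rule decomp)
  have max: "maximal_free_segments G \<phi> M S \<iota> = {\<Sigma>m, \<Sigma>p}"
    by (rule z_decomposition_maximal[OF g z dec])
  \<comment> \<open>The overlap yields a germ of \<open>g'\<close> starting in the interior of
    \<open>pre \<Sigma>m\<close>, which is the half \<open>A\<close> of the decomposition.\<close>
  have overlap: "coset_class G \<phi> S \<iota> g' \<in> {coset_class G \<phi> S \<iota> \<one>\<^bsub>G\<^esub>, coset_class G \<phi> S \<iota> g}"
    if g': "g' \<in> carrier G" and ov: "overlaps \<phi> M S \<iota> g' \<Sigma>m (points S)" for g'
    by (rule overlaps_germ[OF g' ov]) (rule coset_class_germ_from_A[OF g'])
  have unique: "z' = z \<and> coset_class G \<phi> S \<iota> g' = coset_class G \<phi> S \<iota> g"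
    if z': "z' \<in> seg_interior D \<upsilon> (points S)" and g': "g' \<in> carrier G"
      and dec': "z_decomposition G \<phi> M S \<iota> D \<upsilon> z' g' \<Sigma>m' \<Sigma>p'" for z' g' \<Sigma>m' \<Sigma>p'
  proof -
    obtain c' where c': "\<upsilon> c' = z'"
      and decomp': "decomposition G M \<phi> S \<iota> D \<upsilon> c' g' (interior (pre \<Sigma>m')) (interior (pre \<Sigma>p'))"
      by (rule z_decomposition_imp_decomposition[OF g' z' dec'])
    \<comment> \<open>Both decompositions have the maximal free segments as halves, and the halves
      of each meet exactly in its base point, so the base points agree.\<close>
    have "{\<Sigma>m', \<Sigma>p'} = {\<Sigma>m, \<Sigma>p}"
      using max z_decomposition_maximal[OF g' z' dec'] by simp
    hence "\<Sigma>m' \<inter> \<Sigma>p' = \<Sigma>m \<inter> \<Sigma>p" by (auto simp: doubleton_eq_iff)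
    moreover have "\<Sigma>m \<inter> \<Sigma>p = {z}"
      using dec unfolding z_decomposition_def by (elim conjE exE)
    moreover have "\<Sigma>m' \<inter> \<Sigma>p' = {z'}"
      using dec' unfolding z_decomposition_def by (elim conjE exE)
    ultimately have "z' = z" by simp
    have "c' \<in> D" "c \<in> D"
      using decomposition.c_interior[OF decomp'] c_interior interior_D by blast+
    hence "c' = c" using inj_onD[OF inj_\<upsilon>, of c' c] c c' \<open>z' = z\<close> by simp
    thus ?thesis
      using coset_class_germ_c[OF g'] decomposition.germ_c[OF decomp'] decomposition.g_nontrivial[OF decomp']
        \<open>z' = z\<close> by simp
  qed
  show ?thesis
  proof (intro conjI[OF max conjI[OF _ conjI[OF coset_class_inv]]] ballI allI impI)
  qed (use overlap unique in simp_all)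
qed

end
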